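(* Let $n$ be a positive integer and write $8n+17=3^{\beta}n_1$ with $n_1$ a positive integer and $3\nmid n_1$. Then $$t(1,1,3,12;n)=\sigma(n_1)-a(8n+17).$$
   Context: $\sigma(n)=\sum_{d\mid n,\,d\ge1}d$. The integers $a(n)$ ($n\ge1$) are defined by $q\prod_{k=1}^{\infty}(1-q^{2k})(1-q^{4k})(1-q^{6k})(1-q^{12k})=\sum_{n=1}^{\infty}a(n)q^n$ for $|q|<1$. For positive integers $a,b,c,d$ and a nonnegative integer $n$, $t(a,b,c,d;n)$ denotes the number of $(x,y,z,w)\in\mathbb Z^4$ with $n=a\frac{x(x-1)}2+b\frac{y(y-1)}2+c\frac{z(z-1)}2+d\frac{w(w-1)}2$. *)

theory Defs
  imports "HOL-Complex_Analysis.Complex_Analysis"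
begin

definition sigma_div :: "nat \<Rightarrow> nat" where
  "sigma_div n = (\<Sum>d | d dvd n. d)"

text \<open>
  The division by 2 is exact, since \<open>x * (x - 1)\<close> is even.
\<close>
definition t_rep :: "nat \<Rightarrow> nat \<Rightarrow> nat \<Rightarrow> nat \<Rightarrow> nat \<Rightarrow> nat" where
  "t_rep a b c d n = card {(x :: int, y :: int, z :: int, w :: int).
     int n = int a * (x * (x - 1) div 2) + int b * (y * (y - 1) div 2)
           + int c * (z * (z - 1) div 2) + int d * (w * (w - 1) div 2)}"

definition eta_factor :: "nat \<Rightarrow> 'a :: comm_ring_1 \<Rightarrow> 'a" where
  "eta_factor k q = (1 - q ^ (2 * k)) * (1 - q ^ (4 * k)) * (1 - q ^ (6 * k)) * (1 - q ^ (12 * k))"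

text \<open>
  The infinite product is taken in the ring of formal power series over the integers, whose
  topology is coefficientwise stabilisation. That the product converges there, and that the
  resulting coefficients are those of the analytic product on the unit disc (which determines
  them), is shown in \<open>eta_factor_fps_has_prod\<close>, \<open>eta_coeff_sums\<close> and \<open>eta_coeff_unique\<close> below.
\<close>
definition eta_coeff :: "nat \<Rightarrow> int" where
  "eta_coeff n = fps_nth (fps_X * (\<Prod>k. eta_factor (Suc k) fps_X)) n"


lemma finite_t_rep:
  assumes "a > 0" "b > 0" "c > 0" "d > 0"
  shows "finite {(x :: int, y :: int, z :: int, w :: int).
     int n = int a * (x * (x - 1) div 2) + int b * (y * (y - 1) div 2)
           + int c * (z * (z - 1) div 2) + int d * (w * (w - 1) div 2)}" (is "finite ?S")
proof -
  define T where "T = (\<lambda>x::int. x * (x - 1) div 2)"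
  have T0: "T x \<ge> 0" for x
  proof -
    have "x * (x - 1) \<ge> 0"
      by (cases "x \<ge> 1") (auto intro: mult_nonneg_nonneg mult_nonpos_nonpos)
    thus ?thesis by (simp add: T_def)
  qed
  have Tb: "x \<in> {- (2 * int n + 2)..2 * int n + 2}" if "T x \<le> int n" for x
  proof (rule ccontr)
    assume "\<not> ?thesis"
    hence "\<bar>x\<bar> > 2 * int n + 2" by auto
    have "x * (x - 1) < 2 * int n + 2"
      using that by (simp add: T_def)
    moreover have "x * (x - 1) \<ge> 2 * int n + 2"
    proof (cases "x \<ge> 0")
      case True
      hence "x * (x - 1) \<ge> x * 1"
        using \<open>\<bar>x\<bar> > _\<close> by (intro mult_left_mono) auto
      thus ?thesis using \<open>\<bar>x\<bar> > _\<close> True by linarith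
    next
      case False
      hence "(-x) * (1 - x) \<ge> (-x) * 1"
        by (intro mult_left_mono) auto
      moreover have "(-x) * (1 - x) = x * (x - 1)" by (simp add: algebra_simps)
      ultimately show ?thesis using \<open>\<bar>x\<bar> > _\<close> False by linarith
    qed
    ultimately show False by simp
  qed
  let ?I = "{- (2 * int n + 2)..2 * int n + 2}"
  have "?S \<subseteq> ?I \<times> ?I \<times> ?I \<times> ?I"
  proof (clarify, unfold mem_Times_iff fst_conv snd_conv)
    fix x y z w :: int
    assume "int n = int a * (x * (x - 1) div 2) + int b * (y * (y - 1) div 2)
           + int c * (z * (z - 1) div 2) + int d * (w * (w - 1) div 2)"
    hence eq: "int n = int a * T x + int b * T y + int c * T z + int d * T w"
      by (simp add: T_def)
    have "T v \<le> int e * T v" if "e > 0" for e v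
      using mult_right_mono[of 1 "int e" "T v"] that T0 by simp
    from this[OF assms(1), of x] this[OF assms(2), of y]
         this[OF assms(3), of z] this[OF assms(4), of w]
    have "T x \<le> int n" "T y \<le> int n" "T z \<le> int n" "T w \<le> int n"
      using eq T0[of x] T0[of y] T0[of z] T0[of w] by linarith+
    thus "x \<in> ?I \<and> y \<in> ?I \<and> z \<in> ?I \<and> w \<in> ?I"
      using Tb by blast
  qed
  thus ?thesis
    by (rule finite_subset) auto
qed

lemma eta_factor_dvd: "q ^ (2 * k) dvd eta_factor k q - (1 :: 'a :: comm_ring_1)"
proof -
  have comb: "p dvd u * v - 1" if "p dvd u - 1" "p dvd v - 1" for p u v :: 'a
  proof -
    have "u * v - 1 = (u - 1) * v + (v - 1)" by (simp add: algebra_simps)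
    thus ?thesis using that by (simp only: dvd_add dvd_mult2)
  qed
  have "q ^ (2 * k) dvd (1 - q ^ (m * k)) - 1" if "m \<ge> 2" for m
    using that by (simp add: le_imp_power_dvd)
  thus ?thesis unfolding eta_factor_def by (intro comb) simp_all
qed

lemma eta_factor_fps_has_prod:
  "(\<lambda>k. eta_factor (Suc k) (fps_X :: int fps)) has_prod (\<Prod>k. eta_factor (Suc k) fps_X)"
  "(\<lambda>N. \<Prod>k<N. eta_factor (Suc k) (fps_X :: int fps)) \<longlonglongrightarrow> (\<Prod>k. eta_factor (Suc k) fps_X)"
proof -
  define f where "f = (\<lambda>k. eta_factor (Suc k) (fps_X :: int fps))"
  define P where "P = (\<lambda>N. \<Prod>k<N. f k)"
  have step: "fps_nth (P (Suc N)) n = fps_nth (P N) n" if "n \<le> N" for n N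
  proof -
    from eta_factor_dvd[of "fps_X :: int fps" "Suc N"] obtain g
      where g: "f N - 1 = fps_X ^ (2 * Suc N) * g" by (auto simp: f_def dvd_def)
    have "P (Suc N) = P N + P N * (f N - 1)"
      by (simp add: P_def algebra_simps)
    also have "\<dots> = P N + fps_X ^ (2 * Suc N) * (P N * g)"
      by (subst g) (simp only: mult_ac)
    finally show ?thesis using that
      by (simp only: fps_add_nth fps_X_power_mult_nth) auto
  qed
  have stable: "fps_nth (P N) n = fps_nth (P n) n" if "n \<le> N" for n N
    using that by (induction rule: dec_induct) (simp_all add: step)
  define L where "L = Abs_fps (\<lambda>n. fps_nth (P n) n)"
  have lim: "P \<longlonglongrightarrow> L"
    by (rule tendsto_fpsI)
       (auto simp: L_def intro!: eventually_mono[OF eventually_ge_at_top] stable)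
  have "fps_nth L 0 = 1" by (simp add: L_def P_def)
  hence "L \<noteq> 0" by auto
  have "(\<lambda>n. \<Prod>i\<le>n. f i) \<longlonglongrightarrow> L"
    using LIMSEQ_lessThan_iff_atMost[of "\<lambda>A. prod f A" L] lim by (simp add: P_def)
  hence "f has_prod L"
    using \<open>L \<noteq> 0\<close> by (simp add: has_prod_def raw_has_prod_def)
  moreover have "prodinf f = L"
    unfolding prodinf_def
  proof (rule the_equality)
    show "f has_prod L" by fact
    fix p assume "f has_prod p"
    have nz: "f i \<noteq> 0" for i
    proof
      assume "f i = 0"
      hence "P (Suc i) = 0" by (simp add: P_def)
      hence "fps_nth (P (Suc i)) 0 = 0" by simp
      thus False using stable[of 0 "Suc i"] \<open>fps_nth L 0 = 1\<close> by (simp add: L_def)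
    qed
    hence "(\<lambda>n. \<Prod>i\<le>n. f i) \<longlonglongrightarrow> p"
      using \<open>f has_prod p\<close> by (auto simp: has_prod_def raw_has_prod_def)
    thus "p = L"
      using \<open>(\<lambda>n. \<Prod>i\<le>n. f i) \<longlonglongrightarrow> L\<close> LIMSEQ_unique by blast
  qed
  ultimately show "(\<lambda>k. eta_factor (Suc k) (fps_X :: int fps)) has_prod (\<Prod>k. eta_factor (Suc k) fps_X)"
    and "(\<lambda>N. \<Prod>k<N. eta_factor (Suc k) (fps_X :: int fps)) \<longlonglongrightarrow> (\<Prod>k. eta_factor (Suc k) fps_X)"
    using lim by (simp_all add: f_def P_def)
qed

lemma norm_eta_factor_le:
  fixes q :: complex
  assumes "norm q \<le> r" "r \<le> 1"
  shows "norm (eta_factor (Suc k) q - 1) \<le> 15 * r ^ k"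
proof -
  have r0: "r \<ge> 0" using assms(1) norm_ge_zero order_trans by blast
  define s where "s = r ^ k"
  have s: "0 \<le> s" "s \<le> 1" using r0 assms(2) by (auto simp: s_def power_le_one)
  have pw: "norm (1 - q ^ (m * Suc k) - 1) \<le> s" if "m \<ge> 1" for m
  proof -
    have "norm (1 - q ^ (m * Suc k) - 1) = norm q ^ (m * Suc k)"
      by (simp add: norm_power)
    also have "\<dots> \<le> r ^ (m * Suc k)" using assms by (intro power_mono) auto
    also have "\<dots> \<le> r ^ k"
    proof (rule power_decreasing)
      have "1 * Suc k \<le> m * Suc k" using that by (intro mult_right_mono) auto
      thus "k \<le> m * Suc k" by simp
    qed (use r0 assms in auto)
    finally show ?thesis by (simp add: s_def)
  qed
  have comb: "norm (u * v - 1) \<le> A * B + A + B"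
    if "norm (u - 1) \<le> A" "norm (v - 1) \<le> B" for u v :: complex and A B
  proof -
    have "u * v - 1 = (u - 1) * (v - 1) + (u - 1) + (v - 1)" by (simp add: algebra_simps)
    also have "norm \<dots> \<le> norm (u - 1) * norm (v - 1) + norm (u - 1) + norm (v - 1)"
      using norm_triangle_ineq[of "(u - 1) * (v - 1) + (u - 1)" "v - 1"]
        norm_triangle_ineq[of "(u - 1) * (v - 1)" "u - 1"]
      unfolding norm_mult by linarith
    also have "\<dots> \<le> A * B + A + B"
    proof (intro add_mono mult_mono)
      show "0 \<le> A" using that(1) norm_ge_zero order_trans by blast
    qed (use that in auto)
    finally show ?thesis .
  qed
  have "s * s \<le> s" using s by (simp add: mult_left_le)
  have "norm ((1 - q ^ (2 * Suc k)) * (1 - q ^ (4 * Suc k)) - 1) \<le> 3 * s"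
    using comb[OF pw[of 2] pw[of 4]] \<open>s * s \<le> s\<close> by simp
  moreover have "norm ((1 - q ^ (6 * Suc k)) * (1 - q ^ (12 * Suc k)) - 1) \<le> 3 * s"
    using comb[OF pw[of 6] pw[of 12]] \<open>s * s \<le> s\<close> by simp
  ultimately have "norm ((1 - q ^ (2 * Suc k)) * (1 - q ^ (4 * Suc k)) *
       ((1 - q ^ (6 * Suc k)) * (1 - q ^ (12 * Suc k))) - 1) \<le> 3 * s * (3 * s) + 3 * s + 3 * s"
    by (rule comb)
  also have "\<dots> \<le> 15 * s" using \<open>s * s \<le> s\<close> by simp
  finally show ?thesis by (simp only: eta_factor_def s_def mult.assoc)
qed

lemma uniform_limit_eta_factor:
  assumes "r < 1"
  shows "uniform_limit (cball 0 r) (\<lambda>N q. \<Prod>k<N. eta_factor (Suc k) q)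
           (\<lambda>q::complex. \<Prod>k. eta_factor (Suc k) q) sequentially"
proof -
  let ?f = "\<lambda>k (q::complex). eta_factor (Suc k) q"
  have sm: "summable (\<lambda>k. 15 * r ^ k)" if "q \<in> cball 0 r" for q :: complex
  proof -
    have "norm q \<le> r" using that by simp
    hence "norm r < 1" using assms norm_ge_zero[of q] unfolding real_norm_def by linarith
    thus ?thesis by (intro summable_mult summable_geometric)
  qed
  have "uniformly_convergent_on (cball 0 r) (\<lambda>N q. \<Prod>k<N. ?f k q)"
  proof (cases "r \<ge> 0")
    case True
    show ?thesis
    proof (rule uniformly_convergent_on_prod')
      show "uniformly_convergent_on (cball 0 r) (\<lambda>N x. \<Sum>k<N. norm (?f k x - 1))"
      proof (rule Weierstrass_m_test'_ev)
        show "\<forall>\<^sub>F n in sequentially. \<forall>x\<in>cball 0 r. norm (norm (?f n x - 1)) \<le> 15 * r ^ n"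
          using assms by (auto intro!: always_eventually norm_eta_factor_le)
        show "summable (\<lambda>k. 15 * r ^ k)" using sm[of 0] True by simp
      qed
    qed (auto simp: eta_factor_def intro!: continuous_intros)
  next
    case False
    hence "cball 0 r = ({} :: complex set)" by auto
    thus ?thesis by (simp add: uniformly_convergent_on_def)
  qed
  then obtain l where l: "uniform_limit (cball 0 r) (\<lambda>N q. \<Prod>k<N. ?f k q) l sequentially"
    by (auto simp: uniformly_convergent_on_def)
  have "l q = (\<Prod>k. ?f k q)" if "q \<in> cball 0 r" for q
  proof -
    have "summable (\<lambda>k. norm (?f k q - 1))"
      by (rule summable_comparison_test'[OF sm[OF that], of 0])
         (use that assms in \<open>auto intro!: norm_eta_factor_le\<close>)
    hence "convergent_prod (\<lambda>k. ?f k q)"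
      by (intro abs_convergent_prod_imp_convergent_prod summable_imp_abs_convergent_prod)
    hence "(\<lambda>n. \<Prod>k\<le>n. ?f k q) \<longlonglongrightarrow> (\<Prod>k. ?f k q)"
      by (rule convergent_prod_LIMSEQ)
    hence "(\<lambda>n. \<Prod>k<n. ?f k q) \<longlonglongrightarrow> (\<Prod>k. ?f k q)"
      using LIMSEQ_lessThan_iff_atMost[of "\<lambda>A. \<Prod>k\<in>A. ?f k q"] by simp
    moreover have "(\<lambda>n. \<Prod>k<n. ?f k q) \<longlonglongrightarrow> l q"
      using tendsto_uniform_limitI[OF l that] .
    ultimately show ?thesis using LIMSEQ_unique by blast
  qed
  with l show ?thesis
    by (subst uniform_limit_cong'[where g = "\<lambda>N q. \<Prod>k<N. ?f k q" and i = l]) auto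
qed

theorem eta_coeff_sums:
  fixes q :: complex
  assumes "norm q < 1"
  shows "(\<lambda>n. of_int (eta_coeff (Suc n)) * q ^ Suc n) sums (q * (\<Prod>k. eta_factor (Suc k) q))"
proof -
  define r where "r = (norm q + 1) / 2"
  have r: "norm q < r" "r < 1" "r > 0" using assms by (auto simp: r_def add_nonneg_pos)
  define h :: "int fps \<Rightarrow> complex fps" where "h = (\<lambda>f. Abs_fps (\<lambda>n. of_int (fps_nth f n)))"
  have h_mult: "h (f * g) = h f * h g" for f g
    by (rule fps_ext) (simp add: h_def fps_mult_nth)
  have h_1 [simp]: "h 1 = 1" by (rule fps_ext) (simp add: h_def)
  have h_diff: "h (f - g) = h f - h g" for f g by (rule fps_ext) (simp add: h_def)
  have h_X [simp]: "h fps_X = fps_X" by (rule fps_ext) (simp add: h_def fps_X_def)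
  have h_pow: "h (f ^ n) = h f ^ n" for f n by (induction n) (simp_all add: h_mult)
  have h_factor: "h (eta_factor k fps_X) = eta_factor k fps_X" for k
    by (simp add: eta_factor_def h_mult h_diff h_pow)
  have h_prod: "h (\<Prod>k<N. eta_factor (Suc k) fps_X) = (\<Prod>k<N. eta_factor (Suc k) fps_X)" for N
    by (induction N) (simp_all add: h_mult h_factor)
  define F where "F = h (\<Prod>k. eta_factor (Suc k) fps_X)"
  let ?G = "\<lambda>q::complex. \<Prod>k. eta_factor (Suc k) q"
  have lim1: "(\<lambda>N. \<Prod>k<N. eta_factor (Suc k) (fps_X :: complex fps)) \<longlonglongrightarrow> F"
  proof (rule tendsto_fpsI)
    fix n
    have "\<forall>\<^sub>F N in sequentially. fps_nth (\<Prod>k<N. eta_factor (Suc k) (fps_X :: int fps)) n =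
            fps_nth (\<Prod>k. eta_factor (Suc k) fps_X) n"
      using eta_factor_fps_has_prod(2) unfolding tendsto_fps_iff by blast
    thus "\<forall>\<^sub>F N in sequentially. fps_nth (\<Prod>k<N. eta_factor (Suc k) (fps_X :: complex fps)) n = fps_nth F n"
      by eventually_elim (simp add: F_def h_def flip: h_prod)
  qed
  have ul: "uniform_limit (cball 0 r) (\<lambda>N q. \<Prod>k<N. eta_factor (Suc k) q) ?G sequentially"
    by (rule uniform_limit_eta_factor) fact
  have ul': "uniform_limit (ball 0 r) (\<lambda>N q. \<Prod>k<N. eta_factor (Suc k) q) ?G sequentially"
    by (rule uniform_limit_on_subset[OF ul]) auto
  have holo_fin: "(\<lambda>q. \<Prod>k<N. eta_factor (Suc k) q) holomorphic_on A" for N and A :: "complex set"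
    unfolding eta_factor_def by (intro holomorphic_intros)
  have holo: "?G holomorphic_on ball 0 r"
  proof (rule holomorphic_uniform_sequence[OF _ holo_fin])
    fix x assume "x \<in> ball (0::complex) r"
    then obtain d where d: "d > 0" "cball x d \<subseteq> ball 0 r"
      using open_contains_cball[of "ball (0::complex) r"] by blast
    thus "\<exists>d>0. cball x d \<subseteq> ball 0 r \<and> uniform_limit (cball x d)
             (\<lambda>N q. \<Prod>k<N. eta_factor (Suc k) q) ?G sequentially"
      using uniform_limit_on_subset[OF ul'] by blast
  qed auto
  have ex: "?G has_fps_expansion fps_expansion ?G 0"
    using holo r by (intro has_fps_expansion_fps_expansion[of "ball 0 r"]) auto
  have "fps_expansion ?G 0 = F"
  proof (rule uniform_limit_imp_fps_expansion_eq[OF lim1 ul' _ ex])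
    show "\<forall>\<^sub>F N in sequentially. (\<lambda>q. \<Prod>k<N. eta_factor (Suc k) q) has_fps_expansion
            (\<Prod>k<N. eta_factor (Suc k) (fps_X :: complex fps))"
      unfolding eta_factor_def
      by (intro always_eventually allI has_fps_expansion_prod has_fps_expansion_mult
            has_fps_expansion_diff has_fps_expansion_1 has_fps_expansion_fps_X_power)
  qed (use r holo_fin in auto)
  with ex have ex': "?G has_fps_expansion F" by simp
  have "(\<lambda>n. fps_nth F n * q ^ n) sums ?G q"
    by (rule has_fps_expansion_imp_sums_complex[OF ex', of "ereal r"]) (use holo r in auto)
  hence "(\<lambda>n. q * (fps_nth F n * q ^ n)) sums (q * ?G q)"
    by (rule sums_mult)
  moreover have "fps_nth F n = of_int (eta_coeff (Suc n))" for n
    by (simp add: F_def h_def eta_coeff_def)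
  ultimately show ?thesis by (simp add: mult_ac)
qed

theorem eta_coeff_unique:
  fixes a :: "nat \<Rightarrow> int"
  assumes "\<And>q::complex. norm q < 1 \<Longrightarrow>
    (\<lambda>n. of_int (a (Suc n)) * q ^ Suc n) sums (q * (\<Prod>k. eta_factor (Suc k) q))"
  assumes "n \<ge> 1"
  shows "a n = eta_coeff n"
proof -
  define c :: "nat \<Rightarrow> complex"
    where "c = (\<lambda>n. if n = 0 then 0 else of_int (a n) - of_int (eta_coeff n))"
  have "(\<lambda>n. c n * q ^ n) sums 0" if "norm q < 1" for q
  proof -
    have "(\<lambda>n. c (Suc n) * q ^ Suc n) sums 0"
      using sums_diff[OF assms(1)[OF that] eta_coeff_sums[OF that]]
      by (simp add: c_def algebra_simps)
    from sums_Suc[OF this] show ?thesis by (simp add: c_def)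
  qed
  hence z: "(\<lambda>n. c n * (q - 0) ^ n) sums 0" if "q \<in> ball 0 1" for q :: complex
    using that by auto
  have "c = (\<lambda>_. 0)"
  proof (rule ccontr)
    assume "c \<noteq> (\<lambda>_. 0)"
    then obtain m where m: "c m \<noteq> 0" by auto
    hence "m > 0" by (cases m) (auto simp: c_def)
    obtain s where s: "s > 0" "\<And>w::complex. w \<in> cball 0 s - {0} \<Longrightarrow> (0::complex) \<noteq> 0"
      by (rule powser_0_nonzero[of 1 0 c "\<lambda>_. 0" m]) (use z m \<open>m > 0\<close> in auto)
    from s(2)[of "of_real s"] s(1) show False by auto
  qed
  hence "c n = 0" by simp
  thus ?thesis using assms(2) by (simp add: c_def)
qed

end

theory Submission
  imports Defs
begin

text \<open>
  Write \<open>\<psi>(q) = \<Sum>_{j \<ge> 0} q^(j(j+1)/2)\<close>, \<open>\<phi>(q) = \<Sum>_{x \<in> \<int>} q^(x^2)\<close>,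
  \<open>f_k = \<Prod>_{s \<ge> 1} (1 - q^(ks))\<close>, \<open>D = q d/dq\<close>, and \<open>N = 8n + 17\<close>.
  Multiplication by a sixth root of unity in the Eisenstein integers gives
  \<open>\<psi>(q) \<psi>(q^3) = P + q Q\<close> with \<open>P = \<psi>(q^4) \<phi>(q^6)\<close> and \<open>Q = \<phi>(q^2) \<psi>(q^12)\<close>, both even in \<open>q\<close>.
  Since \<open>\<psi>(q) \<psi>(-q) = f_2 f_4\<close>, the eta product is
  \<open>q (P + q Q) (P - q Q)\<close>, so at odd exponents it differs from \<open>q \<psi>(q)^2 \<psi>(q^3)^2\<close> by \<open>2 q^3 Q^2\<close>;
  the coefficient of \<open>q^N\<close> in \<open>2 q^3 Q^2\<close> is \<open>t(1,1,3,12;n)\<close> by a change of variables.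

  The divisor sum comes from \<open>q \<psi>(q)^2 \<psi>(q^3)^2\<close>. By Jacobi and Gauss, \<open>\<phi>(-q) \<psi>(q)^2 = f_2^3 = \<Sum>_{j \<ge> 0} (-1)^j (2j+1) q^(j(j+1))\<close>,
  and a further rotation of the Eisenstein lattice shows that the Wronskian
  \<open>\<phi>(-q) D\<phi>(-q^3) - \<phi>(-q^3) D\<phi>(-q)\<close> equals \<open>2 q f_2^3 f_6^3\<close>. Dividing by
  \<open>\<phi>(-q) \<phi>(-q^3)\<close> identifies \<open>2 q \<psi>(q)^2 \<psi>(q^3)^2\<close> with the logarithmic derivative of
  \<open>\<phi>(-q^3) / \<phi>(-q)\<close>, a combination of divisor-sum series because \<open>\<phi>(-q) = f_1^2 / f_2\<close>.
\<close>

section \<open>A finite form of the Jacobi triple product\<close>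

text \<open>The Gaussian binomial coefficient, given by a q-Pascal rule rather than as a quotient,
  so that it makes sense for any q in any commutative ring.\<close>

fun qbinom :: "'a::comm_ring_1 \<Rightarrow> nat \<Rightarrow> nat \<Rightarrow> 'a" where
  "qbinom q n 0 = 1"
| "qbinom q 0 (Suc k) = 0"
| "qbinom q (Suc n) (Suc k) = qbinom q n k + q ^ Suc k * qbinom q n (Suc k)"

lemma qbinom_eq_0: "n < k \<Longrightarrow> qbinom q n k = 0"
  by (induction q n k rule: qbinom.induct) auto

lemma qbinom_self [simp]: "qbinom q n n = 1"
  by (induction n) (auto simp: qbinom_eq_0)

text \<open>The mirror image of the defining q-Pascal rule, with the power of q on the other term.
  Expanding by one rule and then by the other gives the same four terms in either order.\<close>

lemma qbinom_Suc_Suc_alt: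
  "k \<le> n \<Longrightarrow> qbinom q (Suc n) (Suc k) = q ^ (n - k) * qbinom q n k + qbinom q n (Suc k)"
proof (induction n arbitrary: k)
  case 0
  then show ?case by simp
next
  case (Suc n)
  show ?case
  proof (cases k)
    case 0
    have "qbinom q (Suc (Suc n)) (Suc 0) = 1 + q * qbinom q (Suc n) (Suc 0)"
      by simp
    also have "\<dots> = 1 + q * (q ^ n + qbinom q n (Suc 0))"
      using Suc.IH[of 0] by simp
    finally show ?thesis
      using 0 by (simp add: algebra_simps)
  next
    case (Suc j)
    show ?thesis
    proof (cases "k \<le> n")
      case True
      have e: "q ^ Suc k * q ^ (n - k) = q ^ Suc n" "q ^ (n - j) * q ^ k = q ^ Suc n"
        unfolding power_add[symmetric] using True Suc by auto
      have "qbinom q (Suc (Suc n)) (Suc k) = qbinom q (Suc n) k + q ^ Suc k * qbinom q (Suc n) (Suc k)"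
        by simp
      also have "\<dots> = (q ^ (n - j) * qbinom q n j + qbinom q n k)
          + q ^ Suc k * (q ^ (n - k) * qbinom q n k + qbinom q n (Suc k))"
        using Suc.IH[of k] Suc.IH[of j] True Suc by simp
      also have "\<dots> = q ^ (n - j) * qbinom q n j + q ^ Suc n * qbinom q n k
          + (qbinom q n k + q ^ Suc k * qbinom q n (Suc k))"
        unfolding e(1)[symmetric] by (simp add: algebra_simps)
      also have "\<dots> = q ^ (n - j) * qbinom q (Suc n) k + qbinom q (Suc n) (Suc k)"
        unfolding e(2)[symmetric] using Suc by (simp add: algebra_simps)
      finally show ?thesis using Suc by simp
    next
      case False
      then have "k = Suc n" using Suc.prems by simp
      then show ?thesis by (simp add: qbinom_eq_0)
    qed
  qed
qed

text \<open>The reflection k -> n - k exchanges the two q-Pascal rules.\<close>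

lemma qbinom_symmetric: "k \<le> n \<Longrightarrow> qbinom q n (n - k) = qbinom q n k"
proof (induction n arbitrary: k)
  case 0
  then show ?case by simp
next
  case (Suc n)
  show ?case
  proof (cases k)
    case 0
    then show ?thesis by simp
  next
    case (Suc j)
    show ?thesis
    proof (cases "j = n")
      case True
      then show ?thesis using Suc by simp
    next
      case False
      then have j: "j < n" using Suc \<open>k \<le> Suc n\<close> by simp
      then have "qbinom q (Suc n) (Suc n - k) = qbinom q (Suc n) (Suc (n - Suc j))"
        using Suc by (simp add: Suc_diff_Suc)
      also have "\<dots> = q ^ Suc j * qbinom q n (n - Suc j) + qbinom q n (n - j)"
        using j by (subst qbinom_Suc_Suc_alt) (auto simp: Suc_diff_Suc)
      also have "\<dots> = q ^ Suc j * qbinom q n (Suc j) + qbinom q n j"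
        using j Suc.IH[of j] Suc.IH[of "Suc j"] by simp
      finally show ?thesis using Suc by simp
    qed
  qed
qed

text \<open>One q-Pascal rule after the other passes from row m to row m + 2. This is the step from
  row 2n + 1 to row 2n + 3 in \<open>jacobi_triple_finite\<close>.\<close>

lemma qbinom_two_steps:
  assumes "Suc k \<le> m"
  shows "qbinom q (Suc (Suc m)) (Suc (Suc k)) =
    q ^ (m - k) * qbinom q m k + (1 + q ^ Suc m) * qbinom q m (Suc k)
      + q ^ Suc (Suc k) * qbinom q m (Suc (Suc k))"
proof -
  have e: "q ^ Suc (Suc k) * q ^ (m - Suc k) = q ^ Suc m"
    unfolding power_add[symmetric] using assms by simp
  have "qbinom q (Suc (Suc m)) (Suc (Suc k))
      = qbinom q (Suc m) (Suc k) + q ^ Suc (Suc k) * qbinom q (Suc m) (Suc (Suc k))"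
    by (simp del: power_Suc)
  also have "\<dots> = q ^ (m - k) * qbinom q m k + qbinom q m (Suc k)
      + q ^ Suc (Suc k) * (q ^ (m - Suc k) * qbinom q m (Suc k) + qbinom q m (Suc (Suc k)))"
    using assms qbinom_Suc_Suc_alt[of k m q] qbinom_Suc_Suc_alt[of "Suc k" m q] by (simp only: Suc_leD)
  also have "\<dots> = q ^ (m - k) * qbinom q m k + (1 + q ^ Suc m) * qbinom q m (Suc k)
      + q ^ Suc (Suc k) * qbinom q m (Suc (Suc k))"
    unfolding e[symmetric] by (simp add: algebra_simps del: power_Suc)
  finally show ?thesis .
qed

text \<open>With \<open>c = z + 1/z\<close> this is \<open>z^(-j) + \<dots> + z^j\<close>.\<close>
fun dirichlet_poly :: "'a::comm_ring_1 \<Rightarrow> nat \<Rightarrow> 'a" where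
  "dirichlet_poly c 0 = 1"
| "dirichlet_poly c (Suc 0) = 1 + c"
| "dirichlet_poly c (Suc (Suc j)) = c * dirichlet_poly c (Suc j) - dirichlet_poly c j"

text \<open>The value at z = 1; together with the value at z = -1 below it specialises the triple
  product to the identities of Jacobi and Gauss.\<close>

lemma dirichlet_poly_2: "dirichlet_poly 2 j = of_nat (2 * j + 1)"
  by (induction "2 :: 'a" j rule: dirichlet_poly.induct) (auto simp: algebra_simps)

lemma dirichlet_poly_minus_2: "dirichlet_poly (- 2) j = (- 1) ^ j"
  by (induction "- 2 :: 'a" j rule: dirichlet_poly.induct) (auto simp: algebra_simps)

text \<open>With c = z + 1/z each factor is (1 - z q^(k+1)) (1 - q^(k+1)/z). This is the finite
  triple product divided by 1 - 1/z: the indices j and -j-1 share the exponent j(j+1)/2, and their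
  terms merge into \<open>dirichlet_poly c j\<close>.\<close>

lemma jacobi_triple_finite:
  fixes c q :: "'a::comm_ring_1"
  shows "(\<Prod>k<n. 1 - c * q ^ Suc k + q ^ (2 * Suc k)) =
    (\<Sum>j\<le>n. (- 1) ^ j * q ^ (j * Suc j div 2) * qbinom q (2 * n + 1) (n - j) * dirichlet_poly c j)"
proof (induction n)
  case 0
  then show ?case by simp
next
  case (Suc n)
  define U where "U = dirichlet_poly c"
  define s where "s = (\<lambda>j. (- 1) ^ j * q ^ (j * Suc j div 2))"
  \<comment> \<open>For j > n the true lower index is negative and the coefficient vanishes, whereas
    the truncated n - j would give 1; hence the explicit 0.\<close>
  define B where "B = (\<lambda>j. if j \<le> n then qbinom q (2 * n + 1) (n - j) else 0)"
  have s_Suc: "s (Suc j) = - s j * q ^ Suc j" for j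
  proof -
    have "Suc j * Suc (Suc j) div 2 = j * Suc j div 2 + Suc j"
      using div_mult_self2[of 2 "j * Suc j" "Suc j"] by (simp add: algebra_simps)
    then show ?thesis by (simp add: s_def power_add algebra_simps)
  qed
  \<comment> \<open>At the centre of the row the neighbouring lower index n + 1 leads back to
    \<open>B 0\<close> by symmetry.\<close>
  have B_0: "qbinom q (2 * n + 3) (n + 1) = (1 + q ^ (2 * n + 2)) * B 0 + q ^ (n + 2) * B 1 + q ^ (n + 1) * B 0"
  proof (cases n)
    case 0
    then show ?thesis by (simp add: B_def algebra_simps numeral_3_eq_3)
  next
    case (Suc k)
    have idx: "Suc (2 * n + 1) = 2 * n + 2" "Suc (2 * n + 2) = 2 * n + 3" "Suc (n - 1) = n"
      "Suc n = n + 1" "2 * n + 1 - (n - 1) = n + 2"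
      using Suc by auto
    have "Suc (n - 1) \<le> 2 * n + 1" using Suc by simp
    note qbinom_two_steps[OF this, of q, unfolded idx]
    moreover have "qbinom q (2 * n + 1) (n + 1) = B 0"
      using qbinom_symmetric[of n "2 * n + 1" q] by (simp add: B_def)
    moreover have "qbinom q (2 * n + 1) (n - 1) = B 1" "qbinom q (2 * n + 1) n = B 0"
      using Suc by (simp_all add: B_def)
    ultimately show ?thesis by (simp only: add_ac)
  qed
  have B_Suc: "qbinom q (2 * n + 3) (n - j) =
      (1 + q ^ (2 * n + 2)) * B (Suc j) + q ^ (n + j + 3) * B (j + 2) + q ^ (n - j) * B j"
    if "j \<le> n" for j
  proof -
    have "j = n \<or> n = j + 1 \<or> n = (n - j - 2) + j + 2"
      using that by linarith
    then consider "j = n" | "n = j + 1" | k where "n = k + j + 2"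
      by blast
    then show ?thesis
    proof cases
      case 1
      then show ?thesis by (simp add: B_def)
    next
      case 2
      have "qbinom q (Suc (Suc (2 * n + 1))) (Suc 0) = 1 + q ^ (2 * n + 2) + q * qbinom q (2 * n + 1) (Suc 0)"
        using qbinom_Suc_Suc_alt[of 0 "2 * n + 1" q] by (simp add: algebra_simps)
      moreover have "Suc (Suc (2 * n + 1)) = 2 * n + 3" "n - j = Suc 0" using 2 by simp_all
      moreover have "B (Suc j) = 1" "B (j + 2) = 0" "B j = qbinom q (2 * n + 1) (Suc 0)"
        using 2 by (simp_all add: B_def del: qbinom.simps(3))
      ultimately show ?thesis by (simp only: mult_1_right mult_zero_right add_0_right power_Suc0_right)
    next
      case 3
      have idx: "Suc (2 * n + 1) = 2 * n + 2" "Suc (2 * n + 2) = 2 * n + 3" "Suc k = n - Suc j"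
        "Suc (n - Suc j) = n - j" "2 * n + 1 - k = n + j + 3"
        using 3 by auto
      have "Suc k \<le> 2 * n + 1" using 3 by simp
      note qbinom_two_steps[OF this, of q, unfolded idx]
      moreover have "qbinom q (2 * n + 1) k = B (j + 2)" "qbinom q (2 * n + 1) (n - Suc j) = B (Suc j)"
        "qbinom q (2 * n + 1) (n - j) = B j"
        using 3 by (simp_all add: B_def)
      ultimately show ?thesis by (simp only: add_ac)
    qed
  qed
  have cU: "c * U (Suc j) = U (Suc (Suc j)) + U j" for j
    by (simp add: U_def)
  have cU0: "c * U 0 = U 1 - U 0"
    by (simp add: U_def)
  let ?Q = "q ^ Suc n"
  have "(\<Sum>j\<le>Suc n. s j * qbinom q (2 * Suc n + 1) (Suc n - j) * U j)
    = s 0 * qbinom q (2 * n + 3) (n + 1) * U 0 + (\<Sum>j\<le>n. s (Suc j) * qbinom q (2 * n + 3) (n - j) * U (Suc j))"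
    by (subst sum.atMost_Suc_shift) (simp add: eval_nat_numeral)
  also have "(\<Sum>j\<le>n. s (Suc j) * qbinom q (2 * n + 3) (n - j) * U (Suc j)) =
    (\<Sum>j\<le>n. (1 + q ^ (2 * n + 2)) * (s (Suc j) * B (Suc j) * U (Suc j))
       + (- ?Q) * (s (j + 2) * B (j + 2) * U (Suc j)) + (- ?Q) * (s j * B j * U (Suc j)))"
  proof (rule sum.cong[OF refl])
    fix j assume "j \<in> {..n}"
    then have j: "j \<le> n" by simp
    have e: "?Q = q ^ (n - j) * q ^ Suc j"
      unfolding power_add[symmetric] using j by simp
    \<comment> \<open>The triangular exponents in \<open>s\<close> absorb the powers of q coming
      from \<open>B_Suc\<close>, which leaves the common factor q^(n+1) in both shifted
      terms.\<close>
    have e1: "- (?Q * s (j + 2)) = s (Suc j) * q ^ (n + j + 3)"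
      using s_Suc[of "Suc j"] by (simp add: power_add algebra_simps eval_nat_numeral)
    have e2: "- (?Q * s j) = s (Suc j) * q ^ (n - j)"
      using s_Suc[of j] unfolding e by (simp add: algebra_simps)
    have "s (Suc j) * qbinom q (2 * n + 3) (n - j) * U (Suc j)
      = (1 + q ^ (2 * n + 2)) * (s (Suc j) * B (Suc j) * U (Suc j))
        + (s (Suc j) * q ^ (n + j + 3)) * (B (j + 2) * U (Suc j)) + (s (Suc j) * q ^ (n - j)) * (B j * U (Suc j))"
      unfolding B_Suc[OF j] by (simp only: ring_distribs mult_ac)
    then show "s (Suc j) * qbinom q (2 * n + 3) (n - j) * U (Suc j) =
      (1 + q ^ (2 * n + 2)) * (s (Suc j) * B (Suc j) * U (Suc j))
       + (- ?Q) * (s (j + 2) * B (j + 2) * U (Suc j)) + (- ?Q) * (s j * B j * U (Suc j))"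
      unfolding e1[symmetric] e2[symmetric] by (simp only: mult_minus_left mult_minus_right mult_ac)
  qed
  also have "\<dots> = (1 + q ^ (2 * n + 2)) * (\<Sum>j\<le>n. s (Suc j) * B (Suc j) * U (Suc j))
       - ?Q * (\<Sum>j\<le>n. s (j + 2) * B (j + 2) * U (Suc j)) - ?Q * (\<Sum>j\<le>n. s j * B j * U (Suc j))"
    by (simp add: sum.distrib sum_subtractf sum_distrib_left sum_negf)
  finally have lhs: "(\<Sum>j\<le>Suc n. s j * qbinom q (2 * Suc n + 1) (Suc n - j) * U j) = 
     s 0 * qbinom q (2 * n + 3) (n + 1) * U 0 + \<dots>" .
  have shift1: "(\<Sum>j\<le>n. s j * B j * U j) = s 0 * B 0 * U 0 + (\<Sum>j\<le>n. s (Suc j) * B (Suc j) * U (Suc j))"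
  proof -
    have "(\<Sum>j\<le>n. s j * B j * U j) = (\<Sum>j\<le>Suc n. s j * B j * U j)"
      by (simp add: B_def)
    then show ?thesis by (simp only: sum.atMost_Suc_shift)
  qed
  have shift2: "(\<Sum>j\<le>n. s (Suc j) * B (Suc j) * U j) = s 1 * B 1 * U 0 + (\<Sum>j\<le>n. s (j + 2) * B (j + 2) * U (Suc j))"
  proof -
    have "(\<Sum>j\<le>n. s (Suc j) * B (Suc j) * U j) = (\<Sum>j\<le>Suc n. s (Suc j) * B (Suc j) * U j)"
      by (simp add: B_def)
    also have "\<dots> = s 1 * B 1 * U 0 + (\<Sum>j\<le>n. s (j + 2) * B (j + 2) * U (Suc j))"
      by (subst sum.atMost_Suc_shift) simp
    finally show ?thesis .
  qed
  \<comment> \<open>The recurrence of \<open>dirichlet_poly\<close> turns multiplication by c into a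
    shift up plus a shift down; the extra term comes from c U(0) = U(1) - U(0).\<close>
  have cS: "c * (\<Sum>j\<le>n. s j * B j * U j) = 
     (\<Sum>j\<le>n. s j * B j * U (Suc j)) + (\<Sum>j\<le>n. s (Suc j) * B (Suc j) * U j) - s 0 * B 0 * U 0"
  proof -
    have a: "(\<Sum>j\<le>n. s j * B j * U (Suc j)) = s 0 * B 0 * U 1 + (\<Sum>j\<le>n. s (Suc j) * B (Suc j) * U (Suc (Suc j)))"
    proof -
      have "(\<Sum>j\<le>n. s j * B j * U (Suc j)) = (\<Sum>j\<le>Suc n. s j * B j * U (Suc j))"
        by (simp add: B_def)
      then show ?thesis by (simp only: sum.atMost_Suc_shift One_nat_def)
    qed
    have "c * (\<Sum>j\<le>n. s j * B j * U j) = s 0 * B 0 * (c * U 0) + (\<Sum>j\<le>n. s (Suc j) * B (Suc j) * (c * U (Suc j)))"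
      unfolding shift1 by (simp add: sum_distrib_left algebra_simps)
    also have "\<dots> = s 0 * B 0 * (U 1 - U 0) + (\<Sum>j\<le>n. s (Suc j) * B (Suc j) * U (Suc (Suc j)))
        + (\<Sum>j\<le>n. s (Suc j) * B (Suc j) * U j)"
      unfolding cU cU0 by (simp add: sum.distrib algebra_simps)
    finally show ?thesis unfolding a by (simp add: algebra_simps)
  qed
  have "(\<Prod>k<Suc n. 1 - c * q ^ Suc k + q ^ (2 * Suc k)) =
     (\<Sum>j\<le>n. s j * B j * U j) * (1 - c * ?Q + q ^ (2 * n + 2))"
    using Suc.IH by (simp add: s_def B_def U_def mult_ac)
  also have "\<dots> = (1 + q ^ (2 * n + 2)) * (\<Sum>j\<le>n. s j * B j * U j) - ?Q * (c * (\<Sum>j\<le>n. s j * B j * U j))"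
    by (simp add: algebra_simps)
  also have "\<dots> = (1 + q ^ (2 * n + 2)) * (s 0 * B 0 * U 0 + (\<Sum>j\<le>n. s (Suc j) * B (Suc j) * U (Suc j)))
     - ?Q * ((\<Sum>j\<le>n. s j * B j * U (Suc j))
        + (s 1 * B 1 * U 0 + (\<Sum>j\<le>n. s (j + 2) * B (j + 2) * U (Suc j))) - s 0 * B 0 * U 0)"
    unfolding cS shift2 unfolding shift1 by simp
  also have "\<dots> = (\<Sum>j\<le>Suc n. s j * qbinom q (2 * Suc n + 1) (Suc n - j) * U j)"
    unfolding lhs B_0 using s_Suc[of 0] by (simp add: algebra_simps)
  finally show ?case by (simp only: s_def U_def)
qed

section \<open>Euler products and the limit of Gaussian binomials\<close>

definition euler_poly :: "'a::comm_ring_1 \<Rightarrow> nat \<Rightarrow> 'a" where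
  "euler_poly q n = (\<Prod>s<n. 1 - q ^ Suc s)"

lemma euler_poly_0 [simp]: "euler_poly q 0 = 1"
  and euler_poly_Suc: "euler_poly q (Suc n) = euler_poly q n * (1 - q ^ Suc n)"
  by (simp_all add: euler_poly_def)

text \<open>The product is (1 - q^(n-k+1)) ... (1 - q^n), so it tends to 1 as n grows; the modulus
  records the error.\<close>

lemma qbinom_mult_euler_poly_cong:
  "k \<le> n \<Longrightarrow> q ^ (n - k + 1) dvd qbinom q n k * euler_poly q k - 1"
proof (induction n arbitrary: k)
  case 0
  then show ?case by simp
next
  case (Suc n)
  show ?case
  proof (cases k)
    case 0
    then show ?thesis by simp
  next
    case (Suc j)
    then have j: "j \<le> n" using \<open>k \<le> Suc n\<close> by simp
    have eq: "qbinom q (Suc n) (Suc j) * euler_poly q (Suc j) - 1 =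
      (1 - q ^ Suc j) * (qbinom q n j * euler_poly q j - 1)
      + q ^ Suc j * (qbinom q n (Suc j) * euler_poly q (Suc j) - 1)"
      by (simp add: euler_poly_Suc algebra_simps)
    have 1: "q ^ (n - j + 1) dvd (1 - q ^ Suc j) * (qbinom q n j * euler_poly q j - 1)"
      using Suc.IH[OF j] by (rule dvd_mult)
    have 2: "q ^ (n - j + 1) dvd q ^ Suc j * (qbinom q n (Suc j) * euler_poly q (Suc j) - 1)"
    proof (cases "j = n")
      case True
      then show ?thesis by simp
    next
      case False
      then have "q ^ (n - Suc j + 1) dvd qbinom q n (Suc j) * euler_poly q (Suc j) - 1"
        using j by (intro Suc.IH) auto
      then have "q ^ Suc j * q ^ (n - Suc j + 1) dvd q ^ Suc j * (qbinom q n (Suc j) * euler_poly q (Suc j) - 1)"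
        by (rule mult_dvd_mono[OF dvd_refl])
      moreover have "q ^ Suc j * q ^ (n - Suc j + 1) = q ^ (n - j + 1) * q ^ j"
        unfolding power_add[symmetric] using j False by (intro arg_cong2[where f=power]) auto
      ultimately show ?thesis using dvd_mult_left by metis
    qed
    show ?thesis unfolding Suc eq using dvd_add[OF 1 2] by simp
  qed
qed

section \<open>Congruences modulo powers of X\<close>

lemma fps_X_power_dvd_iff:
  fixes f :: "'a::comm_ring_1 fps"
  shows "fps_X ^ n dvd f \<longleftrightarrow> (\<forall>i<n. fps_nth f i = 0)"
proof
  assume "fps_X ^ n dvd f"
  then show "\<forall>i<n. fps_nth f i = 0"
    by (auto simp: dvd_def fps_X_power_mult_nth)
next
  assume *: "\<forall>i<n. fps_nth f i = 0"
  have "f = fps_X ^ n * fps_shift n f"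
    by (rule fps_ext) (use * in \<open>auto simp: fps_X_power_mult_nth\<close>)
  then show "fps_X ^ n dvd f" by (rule dvdI)
qed

text \<open>Replaces limit arguments: identities of infinite products are checked on finite
  truncations modulo each power of X.\<close>

lemma fps_eqI_cong:
  fixes f g :: "'a::comm_ring_1 fps"
  assumes "\<And>n. fps_X ^ n dvd f - g"
  shows "f = g"
proof (rule fps_ext)
  fix n
  show "fps_nth f n = fps_nth g n"
    using assms[of "Suc n"] unfolding fps_X_power_dvd_iff by simp
qed

lemma dvd_diff_mult:
  fixes m a b c d :: "'a::comm_ring_1"
  assumes "m dvd a - b" "m dvd c - d"
  shows "m dvd a * c - b * d"
proof -
  have "a * c - b * d = (a - b) * c + b * (c - d)"
    by (simp add: algebra_simps)
  then show ?thesis using assms by (simp only: dvd_add dvd_mult dvd_mult2)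
qed

lemma dvd_diff_power:
  fixes m a b :: "'a::comm_ring_1"
  assumes "m dvd a - b"
  shows "m dvd a ^ n - b ^ n"
  by (induction n) (auto intro: dvd_diff_mult assms)

lemma dvd_diff_trans:
  fixes m a b c :: "'a::comm_ring_1"
  assumes "m dvd a - b" "m dvd b - c"
  shows "m dvd a - c"
  using dvd_add[OF assms] by simp

lemma dvd_diff_sym:
  fixes m a b :: "'a::comm_ring_1"
  shows "m dvd a - b \<longleftrightarrow> m dvd b - a"
  by (metis dvd_minus_iff minus_diff_eq)

text \<open>Only meaningful when \<open>fps_X dvd q\<close>, so that the product converges.\<close>
definition euler_fps :: "'a::comm_ring_1 fps \<Rightarrow> 'a fps" where
  "euler_fps q = Abs_fps (\<lambda>n. fps_nth (euler_poly q n) n)"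

text \<open>Each factor beyond the n-th is 1 - q^s with s > n, hence 1 modulo X^(n+1).\<close>

lemma euler_poly_cong:
  fixes q :: "'a::comm_ring_1 fps"
  assumes "fps_X dvd q" "n \<le> m"
  shows "fps_X ^ Suc n dvd euler_poly q m - euler_poly q n"
  using assms(2)
proof (induction m rule: dec_induct)
  case base
  then show ?case by simp
next
  case (step m)
  have "fps_X ^ Suc n dvd q ^ Suc m"
    using step(1) dvd_trans[OF le_imp_power_dvd dvd_power_same[OF assms(1)]] by (metis Suc_le_mono)
  then have "fps_X ^ Suc n dvd (euler_poly q m - euler_poly q n) - euler_poly q m * q ^ Suc m"
    by (intro dvd_diff step dvd_mult)
  then show ?case by (simp add: euler_poly_Suc algebra_simps)
qed

lemma euler_fps_cong:
  fixes q :: "'a::comm_ring_1 fps"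
  assumes "fps_X dvd q"
  shows "fps_X ^ Suc n dvd euler_fps q - euler_poly q n"
  unfolding fps_X_power_dvd_iff
proof (intro allI impI)
  fix i assume "i < Suc n"
  then show "fps_nth (euler_fps q - euler_poly q n) i = 0"
    using euler_poly_cong[OF assms, of i n] unfolding fps_X_power_dvd_iff by (simp add: euler_fps_def)
qed

lemma euler_poly_cong_fps:
  fixes q :: "'a::comm_ring_1 fps"
  assumes "fps_X dvd q" "k \<le> n"
  shows "fps_X ^ k dvd euler_poly q n - euler_fps q"
  using dvd_trans[OF le_imp_power_dvd euler_fps_cong[OF assms(1), of n]] assms(2) dvd_diff_sym le_SucI
  by metis

lemma euler_fps_cong_poly:
  fixes q :: "'a::comm_ring_1 fps"
  assumes "fps_X dvd q" "k \<le> n"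
  shows "fps_X ^ k dvd euler_fps q - euler_poly q n"
  using euler_poly_cong_fps[OF assms] dvd_diff_sym by blast

lemma euler_fps_nth_0 [simp]: "fps_nth (euler_fps q) 0 = (1 :: 'a :: comm_ring_1)"
  by (simp add: euler_fps_def)

lemma euler_fps_nz [simp]: "euler_fps q \<noteq> (0 :: 'a :: comm_ring_1 fps)"
proof
  assume "euler_fps q = 0"
  then have "fps_nth (euler_fps q) 0 = 0" by simp
  then show False by simp
qed

text \<open>In the product of 1 - q^s and 1 - (-q)^s, odd s gives 1 - q^(2s) and even s gives (1 -
  q^s)^2. Altogether this is f_2^3 / f_4 with q^2 and q^4 as arguments, stated without
  division.\<close>

lemma euler_fps_neg:
  fixes q :: "'a::comm_ring_1 fps"
  assumes "fps_X dvd q"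
  shows "euler_fps q * euler_fps (- q) * euler_fps (q ^ 4) = euler_fps (q ^ 2) ^ 3"
proof (rule fps_eqI_cong)
  fix n
  have d: "fps_X dvd - q" "fps_X dvd q ^ 4" "fps_X dvd q ^ 2"
    using assms by (auto intro: dvd_trans[OF _ dvd_power[of 4 q]] dvd_trans[OF _ dvd_power[of 2 q]])
  \<comment> \<open>Truncating at 2n for q and -q but at n for q^4 makes the identity exact, as each
    induction step adds one odd and one even exponent.\<close>
  have fin: "euler_poly q (2 * n) * euler_poly (- q) (2 * n) * euler_poly (q ^ 4) n =
    euler_poly (q ^ 2) (2 * n) * euler_poly (q ^ 2) n ^ 2"
  proof (induction n)
    case 0
    then show ?case by simp
  next
    case (Suc n)
    have p: "(- q) ^ Suc (2 * n) = - (q ^ Suc (2 * n))" "(- q) ^ Suc (Suc (2 * n)) = q ^ Suc (Suc (2 * n))"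
      by simp_all
    have p2: "(q ^ 2) ^ k = (q ^ k) ^ 2" for k
      by (simp add: mult.commute flip: power_mult)
    have p4: "(q ^ 4) ^ Suc n = (q ^ Suc (Suc (2 * n))) ^ 2" "q ^ Suc (Suc (2 * n)) = (q ^ 2) ^ Suc n"
      unfolding power_mult[symmetric] by (rule arg_cong[where f="power q"], simp)+
    have "euler_poly q (2 * Suc n) * euler_poly (- q) (2 * Suc n) * euler_poly (q ^ 4) (Suc n) =
      (euler_poly q (2 * n) * euler_poly (- q) (2 * n) * euler_poly (q ^ 4) n)
      * ((1 - q ^ Suc (2 * n)) * (1 + q ^ Suc (2 * n))) * (1 - q ^ Suc (Suc (2 * n))) ^ 2
      * (1 - (q ^ Suc (Suc (2 * n))) ^ 2)"
      unfolding mult_Suc_right add_2_eq_Suc euler_poly_Suc p p4(1) diff_minus_eq_add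
      by (simp only: power2_eq_square mult_ac)
    also have "(1 - q ^ Suc (2 * n)) * (1 + q ^ Suc (2 * n)) = 1 - (q ^ 2) ^ Suc (2 * n)"
      unfolding p2 by (simp add: power2_eq_square algebra_simps)
    also have "(q ^ Suc (Suc (2 * n)))\<^sup>2 = (q ^ 2) ^ Suc (Suc (2 * n))"
      by (simp only: p2)
    finally show ?case
      unfolding Suc.IH p4(2) mult_Suc_right add_2_eq_Suc euler_poly_Suc power_mult_distrib
      by (simp only: mult_ac)
  qed
  have "fps_X ^ n dvd euler_fps q * euler_fps (- q) * euler_fps (q ^ 4)
      - euler_poly q (2 * n) * euler_poly (- q) (2 * n) * euler_poly (q ^ 4) n"
    by (intro dvd_diff_mult euler_fps_cong_poly assms d) simp_all
  moreover have "fps_X ^ n dvd euler_poly (q ^ 2) (2 * n) * euler_poly (q ^ 2) n ^ 2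
      - euler_fps (q ^ 2) * euler_fps (q ^ 2) ^ 2"
    by (intro dvd_diff_mult dvd_diff_power euler_poly_cong_fps d) simp_all
  ultimately have "fps_X ^ n dvd euler_fps q * euler_fps (- q) * euler_fps (q ^ 4) - euler_fps (q ^ 2) * euler_fps (q ^ 2) ^ 2"
    unfolding fin by (rule dvd_diff_trans)
  then show "fps_X ^ n dvd euler_fps q * euler_fps (- q) * euler_fps (q ^ 4) - euler_fps (q ^ 2) ^ 3"
    by (simp add: power3_eq_cube power2_eq_square mult_ac)
qed

text \<open>The limit of \<open>jacobi_triple_finite\<close>. The term of index j carries
  q^(j(j+1)/2), a multiple of X^j, so its binomial times \<open>euler_fps q\<close> is needed only
  modulo X^(n-j).\<close>

lemma jacobi_triple_cong:
  fixes q :: "'a::comm_ring_1 fps"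
  assumes "fps_X dvd q"
  shows "fps_X ^ n dvd euler_fps q * (\<Prod>k<n. 1 - c * q ^ Suc k + q ^ (2 * Suc k))
    - (\<Sum>j\<le>n. (- 1) ^ j * q ^ (j * Suc j div 2) * dirichlet_poly c j)"
proof -
  have summand: "fps_X ^ n dvd (- 1) ^ j * q ^ (j * Suc j div 2) * dirichlet_poly c j
      * (euler_fps q * qbinom q (2 * n + 1) (n - j) - 1)" if "j \<le> n" for j
  proof -
    let ?b = "qbinom q (2 * n + 1) (n - j)"
    have "fps_X ^ (n - j) dvd ?b * euler_poly q (n - j) - 1"
    proof -
      have "q ^ (2 * n + 1 - (n - j) + 1) dvd ?b * euler_poly q (n - j) - 1"
        by (rule qbinom_mult_euler_poly_cong) simp
      moreover have "fps_X ^ (n - j) dvd q ^ (2 * n + 1 - (n - j) + 1)"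
        by (rule dvd_trans[OF le_imp_power_dvd dvd_power_same[OF assms]]) simp
      ultimately show ?thesis by (rule dvd_trans[rotated])
    qed
    moreover have "fps_X ^ (n - j) dvd ?b * euler_fps q - ?b * euler_poly q (n - j)"
      by (intro dvd_diff_mult euler_fps_cong_poly assms) simp_all
    ultimately have "fps_X ^ (n - j) dvd euler_fps q * ?b - 1"
      using dvd_diff_trans by (metis mult.commute)
    moreover have "fps_X ^ j dvd q ^ (j * Suc j div 2)"
    proof (rule dvd_trans[OF le_imp_power_dvd dvd_power_same[OF assms]])
      have "j * 2 \<le> j * Suc j" by (cases j) auto
      then show "j \<le> j * Suc j div 2" by linarith
    qed
    ultimately have "fps_X ^ j * fps_X ^ (n - j) dvd q ^ (j * Suc j div 2) * (euler_fps q * ?b - 1)"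
      by (intro mult_dvd_mono)
    then have "fps_X ^ n dvd ((- 1) ^ j * dirichlet_poly c j) * (q ^ (j * Suc j div 2) * (euler_fps q * ?b - 1))"
      using that by (simp only: dvd_mult power_add[symmetric] le_add_diff_inverse)
    then show ?thesis by (simp only: mult_ac)
  qed
  have "euler_fps q * (\<Prod>k<n. 1 - c * q ^ Suc k + q ^ (2 * Suc k))
      - (\<Sum>j\<le>n. (- 1) ^ j * q ^ (j * Suc j div 2) * dirichlet_poly c j)
    = (\<Sum>j\<le>n. (- 1) ^ j * q ^ (j * Suc j div 2) * dirichlet_poly c j
      * (euler_fps q * qbinom q (2 * n + 1) (n - j) - 1))"
    unfolding jacobi_triple_finite sum_distrib_left sum_subtractf[symmetric]
    by (rule sum.cong) (simp_all only: ring_distribs mult_ac mult_1_right mult_1_left)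
  also have "fps_X ^ n dvd \<dots>"
    by (intro dvd_sum summand) simp
  finally show ?thesis .
qed

text \<open>For c = 2 every factor of the triple product is (1 - q^s)^2, which together with the
  Euler product in front gives its cube.\<close>

lemma jacobi_cube_cong:
  fixes q :: "'a::comm_ring_1 fps"
  assumes "fps_X dvd q"
  shows "fps_X ^ n dvd euler_fps q ^ 3 - (\<Sum>j\<le>n. (- 1) ^ j * of_nat (2 * j + 1) * q ^ (j * Suc j div 2))"
proof -
  have "(\<Prod>k<n. 1 - 2 * q ^ Suc k + q ^ (2 * Suc k)) = euler_poly q n ^ 2"
    unfolding euler_poly_def prod_power_distrib
    by (intro prod.cong refl) (simp only: power_even_eq, simp add: power2_diff)
  then have "fps_X ^ n dvd euler_fps q * euler_poly q n ^ 2
     - (\<Sum>j\<le>n. (- 1) ^ j * of_nat (2 * j + 1) * q ^ (j * Suc j div 2))"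
    using jacobi_triple_cong[OF assms, of n 2] by (simp only: dirichlet_poly_2 mult_ac)
  moreover have "fps_X ^ n dvd euler_fps q * euler_fps q ^ 2 - euler_fps q * euler_poly q n ^ 2"
    by (intro dvd_diff_mult dvd_diff_power euler_fps_cong_poly assms) simp_all
  ultimately show ?thesis
    unfolding power3_eq_cube power2_eq_square mult.assoc by (blast intro: dvd_diff_trans)
qed

text \<open>For c = -2 every factor is (1 + q^s)^2, and the Euler product of q times all 1 + q^s is
  the Euler product of q^2. One more Euler factor is multiplied in to avoid a quotient.\<close>

lemma gauss_triangular_cong:
  fixes q :: "'a::comm_ring_1 fps"
  assumes "fps_X dvd q"
  shows "fps_X ^ n dvd euler_fps (q ^ 2) ^ 2 - euler_fps q * (\<Sum>j\<le>n. q ^ (j * Suc j div 2))"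
proof -
  let ?P = "\<Prod>k<n. 1 + q ^ Suc k"
  have d: "fps_X dvd q ^ 2"
    using assms by (auto intro: dvd_trans[OF _ dvd_power[of 2 q]])
  have "(\<Prod>k<n. 1 - (- 2) * q ^ Suc k + q ^ (2 * Suc k)) = ?P ^ 2"
    unfolding prod_power_distrib
    by (intro prod.cong refl) (simp only: power_even_eq, simp add: power2_sum)
  moreover have "(- 1) ^ j * x * (- 1) ^ j = x" for j and x :: "'a fps"
    by (simp add: mult_ac flip: power_mult_distrib)
  ultimately have "fps_X ^ n dvd euler_fps q * ?P ^ 2 - (\<Sum>j\<le>n. q ^ (j * Suc j div 2))"
    using jacobi_triple_cong[OF assms, of n "- 2"] by (simp only: dirichlet_poly_minus_2)
  then have 1: "fps_X ^ n dvd euler_fps q * (euler_fps q * ?P ^ 2) - euler_fps q * (\<Sum>j\<le>n. q ^ (j * Suc j div 2))"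
    unfolding right_diff_distrib[symmetric] by (rule dvd_mult)
  have p2: "(q ^ 2) ^ k = (q ^ k) ^ 2" for k
    by (simp add: mult.commute flip: power_mult)
  have P: "euler_poly q n * ?P = euler_poly (q ^ 2) n"
    unfolding euler_poly_def prod.distrib[symmetric]
    by (intro prod.cong refl) (simp only: p2, simp add: power2_eq_square algebra_simps)
  have "fps_X ^ n dvd euler_fps (q ^ 2) ^ 2 - (euler_poly q n * ?P) ^ 2"
    unfolding P by (intro dvd_diff_power euler_fps_cong_poly d) simp_all
  moreover have "fps_X ^ n dvd (euler_poly q n * ?P) ^ 2 - (euler_fps q * ?P) ^ 2"
    by (intro dvd_diff_mult dvd_diff_power euler_poly_cong_fps assms) simp_all
  ultimately have "fps_X ^ n dvd euler_fps (q ^ 2) ^ 2 - (euler_fps q * ?P) ^ 2"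
    by (rule dvd_diff_trans)
  moreover have "(euler_fps q * ?P) ^ 2 = euler_fps q * (euler_fps q * ?P ^ 2)"
    by (simp add: power2_eq_square mult_ac)
  ultimately have "fps_X ^ n dvd euler_fps (q ^ 2) ^ 2 - euler_fps q * (euler_fps q * ?P ^ 2)"
    by (simp only:)
  then show ?thesis using 1 by (rule dvd_diff_trans)
qed

section \<open>Theta series\<close>

text \<open>An infinite fibre of \<open>e\<close> would silently contribute 0, the value of a sum
  over an infinite set; \<open>admissible\<close> rules this out where sums are multiplied or
  split.\<close>

definition theta :: "'i set \<Rightarrow> ('i \<Rightarrow> int) \<Rightarrow> ('i \<Rightarrow> int) \<Rightarrow> int fps" where
  "theta I e w = Abs_fps (\<lambda>n. \<Sum>i | i \<in> I \<and> e i = int n. w i)"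

definition admissible :: "'i set \<Rightarrow> ('i \<Rightarrow> int) \<Rightarrow> bool" where
  "admissible I e \<longleftrightarrow> (\<forall>i\<in>I. 0 \<le> e i) \<and> (\<forall>n. finite {i \<in> I. e i \<le> n})"

lemma theta_nth: "fps_nth (theta I e w) n = (\<Sum>i | i \<in> I \<and> e i = int n. w i)"
  by (simp add: theta_def)

lemma admissible_finite: "admissible I e \<Longrightarrow> finite {i. i \<in> I \<and> e i = n}"
  by (rule finite_subset[of _ "{i \<in> I. e i \<le> n}"]) (auto simp: admissible_def)

lemma admissible_Times:
  assumes "admissible I e" "admissible J f"
  shows "admissible (I \<times> J) (\<lambda>(i, j). e i + f j)"
  unfolding admissible_def
proof (intro conjI allI)
  show "\<forall>p\<in>I \<times> J. 0 \<le> (case p of (i, j) \<Rightarrow> e i + f j)"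
    using assms by (auto simp: admissible_def)
  fix n
  have "{p \<in> I \<times> J. (case p of (i, j) \<Rightarrow> e i + f j) \<le> n} \<subseteq> {i \<in> I. e i \<le> n} \<times> {j \<in> J. f j \<le> n}"
    using assms by (fastforce simp: admissible_def)
  then show "finite {p \<in> I \<times> J. (case p of (i, j) \<Rightarrow> e i + f j) \<le> n}"
    using assms by (rule_tac finite_subset) (auto simp: admissible_def)
qed

lemma theta_mult:
  assumes "admissible I e" "admissible J f"
  shows "theta I e w * theta J f v = theta (I \<times> J) (\<lambda>(i, j). e i + f j) (\<lambda>(i, j). w i * v j)"
proof (rule fps_ext)
  fix n
  let ?S = "{p. p \<in> I \<times> J \<and> (case p of (i, j) \<Rightarrow> e i + f j) = int n}"
  have fin: "finite ?S"
    using admissible_Times[OF assms] by (rule admissible_finite)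
  have "fps_nth (theta I e w * theta J f v) n =
    (\<Sum>k=0..n. (\<Sum>i | i \<in> I \<and> e i = int k. w i) * (\<Sum>j | j \<in> J \<and> f j = int (n - k). v j))"
    by (simp add: fps_mult_nth theta_nth)
  \<comment> \<open>The convolution index k is the exponent of the first component, so the pairs are
    grouped by it.\<close>
  also have "\<dots> = (\<Sum>k=0..n. \<Sum>p | p \<in> ?S \<and> nat (e (fst p)) = k. case p of (i, j) \<Rightarrow> w i * v j)"
  proof (rule sum.cong[OF refl])
    fix k assume k: "k \<in> {0..n}"
    have "{p. p \<in> ?S \<and> nat (e (fst p)) = k} = {i. i \<in> I \<and> e i = int k} \<times> {j. j \<in> J \<and> f j = int (n - k)}"
      using assms k by (auto simp: admissible_def of_nat_diff)
    then show "(\<Sum>i | i \<in> I \<and> e i = int k. w i) * (\<Sum>j | j \<in> J \<and> f j = int (n - k). v j)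
      = (\<Sum>p | p \<in> ?S \<and> nat (e (fst p)) = k. case p of (i, j) \<Rightarrow> w i * v j)"
      by (simp only: sum_product sum.cartesian_product)
  qed
  also have "\<dots> = (\<Sum>p\<in>?S. case p of (i, j) \<Rightarrow> w i * v j)"
    using assms by (intro sum.group fin) (force simp: admissible_def)+
  finally show "fps_nth (theta I e w * theta J f v) n =
    fps_nth (theta (I \<times> J) (\<lambda>(i, j). e i + f j) (\<lambda>(i, j). w i * v j)) n"
    by (simp only: theta_nth)
qed

lemma theta_reindex:
  assumes "\<And>i. i \<in> I \<Longrightarrow> h i \<in> J \<and> g (h i) = i \<and> e' (h i) = e i \<and> w' (h i) = w i"
    and "\<And>j. j \<in> J \<Longrightarrow> g j \<in> I \<and> h (g j) = j"
  shows "theta I e w = theta J e' w'"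
proof (rule fps_ext)
  fix n
  show "fps_nth (theta I e w) n = fps_nth (theta J e' w') n"
    unfolding theta_nth
  proof (rule sum.reindex_bij_witness[where i = g and j = h])
    fix j assume "j \<in> {j. j \<in> J \<and> e' j = int n}"
    then show "g j \<in> {i. i \<in> I \<and> e i = int n}"
      using assms(1)[of "g j"] assms(2)[of j] by auto
  qed (use assms in auto)
qed

lemma theta_cong:
  assumes "\<And>i. i \<in> I \<Longrightarrow> e i = e' i" "\<And>i. i \<in> I \<Longrightarrow> w i = w' i"
  shows "theta I e w = theta I e' w'"
  using assms by (intro theta_reindex[where h = id and g = id]) auto

lemma theta_split:
  assumes "admissible I e"
  shows "theta I e w = theta {i \<in> I. P i} e w + theta {i \<in> I. \<not> P i} e w"
proof (rule fps_ext)
  fix n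
  let ?S = "{i. i \<in> I \<and> e i = int n}"
  have "sum w ?S = sum w {i \<in> ?S. P i} + sum w {i \<in> ?S. \<not> P i}"
    using admissible_finite[OF assms, of "int n"]
    by (subst sum.union_disjoint[symmetric]) (auto intro: sum.cong elim: rev_finite_subset)
  moreover have "{i \<in> ?S. P i} = {i. i \<in> {i \<in> I. P i} \<and> e i = int n}"
    "{i \<in> ?S. \<not> P i} = {i. i \<in> {i \<in> I. \<not> P i} \<and> e i = int n}" by auto
  ultimately show "fps_nth (theta I e w) n =
      fps_nth (theta {i \<in> I. P i} e w + theta {i \<in> I. \<not> P i} e w) n"
    by (simp only: theta_nth fps_add_nth)
qed

lemma theta_add: "theta I e (\<lambda>i. w i + v i) = theta I e w + theta I e v"
  by (rule fps_ext) (simp add: theta_nth sum.distrib)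

lemma theta_diff: "theta I e (\<lambda>i. w i - v i) = theta I e w - theta I e v"
  by (rule fps_ext) (simp add: theta_nth sum_subtractf)

lemma theta_uminus: "theta I e (\<lambda>i. - w i) = - theta I e w"
  by (rule fps_ext) (simp add: theta_nth sum_negf)

lemma theta_shift:
  assumes "\<And>i. i \<in> I \<Longrightarrow> 0 \<le> e i"
  shows "fps_X ^ k * theta I e w = theta I (\<lambda>i. e i + int k) w"
proof (rule fps_ext)
  fix n
  show "fps_nth (fps_X ^ k * theta I e w) n = fps_nth (theta I (\<lambda>i. e i + int k) w) n"
  proof (cases "n < k")
    case True
    then have "{i. i \<in> I \<and> e i + int k = int n} = {}" using assms by fastforce
    then show ?thesis using True by (simp only: theta_nth fps_X_power_mult_nth) simp
  next
    case False
    then have "{i. i \<in> I \<and> e i + int k = int n} = {i. i \<in> I \<and> e i = int (n - k)}"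
      by (auto simp: of_nat_diff)
    then show ?thesis using False by (simp add: theta_nth fps_X_power_mult_nth)
  qed
qed

lemma theta_deriv: "fps_X * fps_deriv (theta I e w) = theta I e (\<lambda>i. e i * w i)"
proof (rule fps_ext)
  fix n
  show "fps_nth (fps_X * fps_deriv (theta I e w)) n = fps_nth (theta I e (\<lambda>i. e i * w i)) n"
    by (cases n) (auto simp: theta_nth sum_distrib_left intro!: sum.cong)
qed

section \<open>The substitution of -q for q\<close>

definition fps_alt :: "'a::comm_ring_1 fps \<Rightarrow> 'a fps" where
  "fps_alt f = Abs_fps (\<lambda>n. (- 1) ^ n * fps_nth f n)"

lemma fps_alt_nth: "fps_nth (fps_alt f) n = (- 1) ^ n * fps_nth f n"
  by (simp add: fps_alt_def)

lemma fps_alt_mult: "fps_alt (f * g) = fps_alt f * fps_alt g"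
proof (rule fps_ext)
  fix n
  have "(- 1) ^ n * (fps_nth f k * fps_nth g (n - k)) =
      ((- 1) ^ k * fps_nth f k) * ((- 1) ^ (n - k) * fps_nth g (n - k))" if "k \<le> n" for k
  proof -
    have "(- 1 :: 'a) ^ n = (- 1) ^ k * (- 1) ^ (n - k)"
      using that by (simp flip: power_add)
    then show ?thesis by (simp only: mult_ac)
  qed
  then show "fps_nth (fps_alt (f * g)) n = fps_nth (fps_alt f * fps_alt g) n"
    by (auto simp: fps_alt_nth fps_mult_nth sum_distrib_left intro!: sum.cong)
qed

lemma fps_alt_1 [simp]: "fps_alt 1 = 1"
  by (rule fps_ext) (simp add: fps_alt_nth)

lemma fps_alt_X [simp]: "fps_alt fps_X = - fps_X"
  by (rule fps_ext) (simp add: fps_alt_nth fps_X_def)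

lemma fps_alt_add: "fps_alt (f + g) = fps_alt f + fps_alt g"
  by (rule fps_ext) (simp add: fps_alt_nth algebra_simps)

lemma fps_alt_diff: "fps_alt (f - g) = fps_alt f - fps_alt g"
  by (rule fps_ext) (simp add: fps_alt_nth algebra_simps)

lemma fps_alt_power: "fps_alt (f ^ n) = fps_alt f ^ n"
  by (induction n) (simp_all add: fps_alt_mult)

lemma fps_alt_numeral [simp]: "fps_alt (numeral n) = numeral n"
  by (rule fps_ext) (simp add: fps_alt_nth fps_numeral_nth)

lemma fps_alt_theta:
  "fps_alt (theta I e w) = theta I e (\<lambda>i. (if even (e i) then w i else - w i))"
proof (rule fps_ext)
  fix n
  show "fps_nth (fps_alt (theta I e w)) n = fps_nth (theta I e (\<lambda>i. (if even (e i) then w i else - w i))) n"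
    by (cases "even n") (auto simp: fps_alt_nth theta_nth sum_negf[symmetric] intro!: sum.cong)
qed

lemma fps_alt_euler_fps:
  fixes q :: "'a::comm_ring_1 fps"
  shows "fps_alt (euler_fps q) = euler_fps (fps_alt q)"
proof -
  have "fps_alt (euler_poly q n) = euler_poly (fps_alt q) n" for n
    by (induction n) (simp_all add: euler_poly_Suc fps_alt_mult fps_alt_diff fps_alt_power)
  then have "fps_nth (euler_poly (fps_alt q) n) n = (- 1) ^ n * fps_nth (euler_poly q n) n" for n
    by (metis fps_alt_nth)
  then show ?thesis
    by (intro fps_ext) (simp add: fps_alt_nth euler_fps_def)
qed

section \<open>Theta series of triangular numbers and squares\<close>

definition tri :: "int \<Rightarrow> int" where
  "tri x = x * (x - 1) div 2"

lemma two_tri: "2 * tri x = x * (x - 1)"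
  by (simp add: tri_def)

lemma tri_nonneg: "0 \<le> tri x"
proof -
  have "x * (x - 1) \<ge> 0"
    by (cases "x \<ge> 1") (auto intro: mult_nonneg_nonneg mult_nonpos_nonpos)
  then show ?thesis by (simp add: tri_def)
qed

lemma tri_reflect: "tri (1 - x) = tri x"
  using two_tri[of x] two_tri[of "1 - x"] by (simp add: algebra_simps)

lemma tri_Suc: "tri (int j + 1) = int (j * Suc j div 2)"
  by (simp add: tri_def zdiv_int algebra_simps)

lemma admissible_square:
  assumes "k > 0"
  shows "admissible UNIV (\<lambda>x. k * x\<^sup>2)"
  unfolding admissible_def
proof (intro conjI allI)
  show "\<forall>x\<in>UNIV. 0 \<le> k * x\<^sup>2" using assms by simp
  fix n
  have "\<bar>x\<bar> \<le> n" if "k * x\<^sup>2 \<le> n" for x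
  proof -
    have "\<bar>x\<bar> \<le> x\<^sup>2"
      using self_le_power[of "\<bar>x\<bar>" 2] by (cases "x = 0") auto
    also have "\<dots> \<le> k * x\<^sup>2" using mult_right_mono[of 1 k "x\<^sup>2"] assms by simp
    finally show ?thesis using that by simp
  qed
  then have "{x \<in> UNIV. k * x\<^sup>2 \<le> n} \<subseteq> {- n..n}" by fastforce
  then show "finite {x \<in> UNIV. k * x\<^sup>2 \<le> n}" by (rule finite_subset) simp
qed

lemma admissible_tri:
  assumes "k > 0"
  shows "admissible UNIV (\<lambda>x. k * tri x)"
  unfolding admissible_def
proof (intro conjI allI)
  show "\<forall>x\<in>UNIV. 0 \<le> k * tri x" using assms by (simp add: tri_nonneg)
  fix n
  have "\<bar>x\<bar> \<le> 2 * n + 1" if "k * tri x \<le> n" for x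
  proof -
    have "tri x \<le> k * tri x" using mult_right_mono[of 1 k "tri x"] assms by (simp add: tri_nonneg)
    then have "x * (x - 1) \<le> 2 * n" using that two_tri[of x] by simp
    moreover have "\<bar>x\<bar> - 1 \<le> x * (x - 1)"
    proof (cases "x \<le> 0")
      case True
      have "0 \<le> x * x" by simp
      then show ?thesis using True unfolding right_diff_distrib by linarith
    next
      case False
      then have "0 \<le> (x - 1) * (x - 1)" by simp
      with False show ?thesis by (simp add: algebra_simps)
    qed
    ultimately show ?thesis by simp
  qed
  then have "{x \<in> UNIV. k * tri x \<le> n} \<subseteq> {- (2 * n + 1)..2 * n + 1}" by fastforce
  then show "finite {x \<in> UNIV. k * tri x \<le> n}" by (rule finite_subset) simp
qed

text \<open>The reflection x -> 1 - x folds the sum onto x > 0, which gives the factor 2; then x = j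
  + 1 produces the exponents j(j+1)/2 of the triple product.\<close>

lemma theta_tri_cong:
  fixes k :: nat
  assumes "k > 0" and "\<And>x. w (1 - x) = w x"
  shows "fps_X ^ n dvd theta UNIV (\<lambda>x. int k * tri x) w
    - 2 * (\<Sum>j\<le>n. of_int (w (int j + 1)) * (fps_X ^ k) ^ (j * Suc j div 2))"
proof -
  let ?e = "\<lambda>x. int k * tri x"
  have adm: "admissible UNIV ?e" using assms(1) by (intro admissible_tri) simp
  have "theta {x \<in> UNIV. \<not> 0 < x} ?e w = theta {x \<in> UNIV. 0 < x} ?e w"
    by (rule theta_reindex[where h = "\<lambda>x. 1 - x" and g = "\<lambda>x. 1 - x"]) (auto simp: assms(2) tri_reflect)
  then have half: "theta UNIV ?e w = 2 * theta {x. 0 < x} ?e w"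
    using theta_split[OF adm, of w "\<lambda>x. 0 < x"] by simp
  have "fps_X ^ n dvd theta {x. 0 < x} ?e w - (\<Sum>j\<le>n. of_int (w (int j + 1)) * (fps_X ^ k) ^ (j * Suc j div 2))"
    unfolding fps_X_power_dvd_iff
  proof (intro allI impI)
    fix m assume m: "m < n"
    have "fps_nth (\<Sum>j\<le>n. of_int (w (int j + 1)) * (fps_X ^ k) ^ (j * Suc j div 2)) m
      = (\<Sum>j\<le>n. if int m = ?e (int j + 1) then w (int j + 1) else 0)"
      unfolding fps_sum_nth
    proof (rule sum.cong[OF refl])
      fix j
      have "(of_int (w (int j + 1)) :: int fps) = fps_const (w (int j + 1))"
        using fps_of_int[of "w (int j + 1)", where 'a = int] by simp
      then show "fps_nth (of_int (w (int j + 1)) * (fps_X ^ k) ^ (j * Suc j div 2)) m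
        = (if int m = ?e (int j + 1) then w (int j + 1) else 0)"
        unfolding tri_Suc of_nat_mult[symmetric] of_nat_eq_iff by (simp add: fps_X_power_nth flip: power_mult)
    qed
    also have "\<dots> = (\<Sum>j | j \<in> {..n} \<and> int m = ?e (int j + 1). w (int j + 1))"
      by (rule sum.inter_filter[symmetric]) simp
    also have "\<dots> = (\<Sum>x | x \<in> {x. 0 < x} \<and> ?e x = int m. w x)"
    proof (rule sum.reindex_bij_witness[where j = "\<lambda>j. int j + 1" and i = "\<lambda>x. nat (x - 1)"])
      fix x assume x: "x \<in> {x. x \<in> {x. 0 < x} \<and> ?e x = int m}"
      \<comment> \<open>The index is bounded by the exponent, so cutting the sum at j = n loses
        nothing below X^n.\<close>
      have "x - 1 \<le> tri x"
      proof -
        have "(x - 1) * 2 \<le> (x - 1) * x"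
          using x mult_left_mono[of 2 x "x - 1"] by (cases "x = 1") auto
        then show ?thesis using two_tri[of x] by (simp add: mult.commute)
      qed
      also have "\<dots> \<le> int m"
        using x mult_right_mono[of 1 "int k" "tri x"] assms(1) by (simp add: tri_nonneg)
      finally show "nat (x - 1) \<in> {j \<in> {..n}. int m = ?e (int j + 1)}"
        using x m by auto
    qed auto
    finally show "fps_nth (theta {x. 0 < x} ?e w
       - (\<Sum>j\<le>n. of_int (w (int j + 1)) * (fps_X ^ k) ^ (j * Suc j div 2))) m = 0"
      by (simp only: fps_sub_nth theta_nth diff_self)
  qed
  then show ?thesis
    unfolding half right_diff_distrib[symmetric] by (rule dvd_mult)
qed

text \<open>Summing over all integers instead of positive ones makes \<open>psi_series k\<close> equal to \<open>2 \<psi>(q^k)\<close>, and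
  \<open>jacobi_series k\<close> equal to \<open>2 \<Sum>_{j \<ge> 0} (-1)^j (2j+1) q^(kj(j+1)/2)\<close>.\<close>
definition psi_series :: "nat \<Rightarrow> int fps" where
  "psi_series k = theta UNIV (\<lambda>x. int k * tri x) (\<lambda>x. 1)"

definition phi_series :: "nat \<Rightarrow> int fps" where
  "phi_series k = theta UNIV (\<lambda>x. int k * x\<^sup>2) (\<lambda>x. 1)"

definition jacobi_series :: "nat \<Rightarrow> int fps" where
  "jacobi_series k = theta UNIV (\<lambda>x. int k * tri x) (\<lambda>x. if odd x then 2 * x - 1 else 1 - 2 * x)"

lemma fps_X_dvd_power: "k > 0 \<Longrightarrow> (fps_X :: 'a::comm_ring_1 fps) dvd fps_X ^ k"
  by (simp add: dvd_power)

text \<open>Gauss's psi(q) = f_2^2 / f_1 at q^k, doubled because \<open>psi_series\<close>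
  is.\<close>

lemma psi_series_product:
  assumes "k > 0"
  shows "psi_series k * euler_fps (fps_X ^ k) = 2 * euler_fps (fps_X ^ (2 * k)) ^ 2"
proof (rule fps_eqI_cong)
  fix n
  let ?q = "fps_X ^ k :: int fps"
  let ?S = "\<Sum>j\<le>n. ?q ^ (j * Suc j div 2)"
  have "fps_X ^ n dvd psi_series k - 2 * ?S"
    using theta_tri_cong[OF assms, of "\<lambda>_. 1" n] by (simp add: psi_series_def)
  then have "fps_X ^ n dvd psi_series k * euler_fps ?q - (2 * ?S) * euler_fps ?q"
    by (rule dvd_diff_mult) simp
  moreover have "fps_X ^ n dvd (2 * ?S) * euler_fps ?q - 2 * euler_fps (?q ^ 2) ^ 2"
    unfolding mult.assoc mult.commute[of ?S] using gauss_triangular_cong[OF fps_X_dvd_power[OF assms], of n]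
    by (intro dvd_diff_mult) (simp_all add: dvd_diff_sym)
  ultimately have "fps_X ^ n dvd psi_series k * euler_fps ?q - 2 * euler_fps (?q ^ 2) ^ 2"
    by (rule dvd_diff_trans)
  moreover have "?q ^ 2 = fps_X ^ (2 * k)" by (simp add: mult.commute flip: power_mult)
  ultimately show "fps_X ^ n dvd psi_series k * euler_fps ?q - 2 * euler_fps (fps_X ^ (2 * k)) ^ 2"
    by simp
qed

lemma jacobi_series_product:
  assumes "k > 0"
  shows "jacobi_series k = 2 * euler_fps (fps_X ^ k) ^ 3"
proof (rule fps_eqI_cong)
  fix n
  let ?q = "fps_X ^ k :: int fps"
  let ?w = "\<lambda>x. if odd x then 2 * x - 1 else 1 - 2 * x :: int"
  have w: "of_int (?w (int j + 1)) = ((- 1) ^ j * of_nat (2 * j + 1) :: int fps)" for j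
    by (cases "even j") (simp_all add: algebra_simps)
  have "fps_X ^ n dvd jacobi_series k - 2 * (\<Sum>j\<le>n. of_int (?w (int j + 1)) * ?q ^ (j * Suc j div 2))"
    unfolding jacobi_series_def by (rule theta_tri_cong[OF assms]) auto
  then have "fps_X ^ n dvd jacobi_series k - 2 * (\<Sum>j\<le>n. (- 1) ^ j * of_nat (2 * j + 1) * ?q ^ (j * Suc j div 2))"
    by (simp only: w)
  moreover have "fps_X ^ n dvd 2 * (\<Sum>j\<le>n. (- 1) ^ j * of_nat (2 * j + 1) * ?q ^ (j * Suc j div 2)) - 2 * euler_fps ?q ^ 3"
    using jacobi_cube_cong[OF fps_X_dvd_power[OF assms], of n]
    by (intro dvd_diff_mult) (simp_all add: dvd_diff_sym)
  ultimately show "fps_X ^ n dvd jacobi_series k - 2 * euler_fps ?q ^ 3"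
    by (rule dvd_diff_trans)
qed

section \<open>Binary theta identities\<close>

lemma fps_alt_psi_euler:
  assumes "k > 0" "odd k"
  shows "fps_alt (psi_series k) * euler_fps (- (fps_X ^ k)) = 2 * euler_fps (fps_X ^ (2 * k)) ^ 2"
proof -
  have "fps_alt (psi_series k * euler_fps (fps_X ^ k)) = fps_alt (2 * euler_fps (fps_X ^ (2 * k)) ^ 2)"
    using psi_series_product[OF assms(1)] by simp
  then show ?thesis
    using assms(2) by (simp add: fps_alt_mult fps_alt_power fps_alt_euler_fps)
qed

lemma euler_fps_neg_X_power:
  assumes "k > 0"
  shows "euler_fps (fps_X ^ k) * euler_fps (- (fps_X ^ k)) * euler_fps (fps_X ^ (4 * k)) =
    (euler_fps (fps_X ^ (2 * k)) ^ 3 :: int fps)"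
  using euler_fps_neg[OF fps_X_dvd_power[OF assms]]
  by (simp add: mult.commute flip: power_mult)

text \<open>By Gauss the left side is f_2^4 over the Euler products of q and -q, up to the factor 4
  from the doubling; that denominator is f_2^3 / f_4.\<close>

lemma psi_series_mult_alt:
  assumes "k > 0" "odd k"
  shows "psi_series k * fps_alt (psi_series k) = 4 * (euler_fps (fps_X ^ (2 * k)) * euler_fps (fps_X ^ (4 * k)))"
proof -
  define a where "a = euler_fps (fps_X ^ k :: int fps)"
  define b where "b = euler_fps (- (fps_X ^ k) :: int fps)"
  define c where "c = euler_fps (fps_X ^ (2 * k) :: int fps)"
  define d where "d = euler_fps (fps_X ^ (4 * k) :: int fps)"
  have 1: "psi_series k * a = 2 * c ^ 2" "fps_alt (psi_series k) * b = 2 * c ^ 2" "a * b * d = c ^ 3"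
    using psi_series_product fps_alt_psi_euler euler_fps_neg_X_power assms by (simp_all add: a_def b_def c_def d_def)
  have "(psi_series k * fps_alt (psi_series k)) * (a * b * d) = (psi_series k * a) * (fps_alt (psi_series k) * b) * d"
    by (simp only: mult_ac)
  also have "\<dots> = (4 * (c * d)) * (a * b * d)"
    unfolding 1 by (simp add: power2_eq_square power3_eq_cube mult_ac)
  finally show ?thesis by (simp add: a_def b_def c_def d_def)
qed

text \<open>The rotation (x, y) -> (y + x, y - x) turns tri + tri into x^2 + 2 tri y and reaches
  exactly the pairs with even difference. Reflecting one coordinate exchanges these with the other
  pairs, hence the factor 2.\<close>

lemma psi_series_square:
  assumes "k > 0"
  shows "psi_series k ^ 2 = 2 * (phi_series k * psi_series (2 * k))"
proof -
  let ?e = "\<lambda>(x, y). int k * tri x + int k * tri y"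
  have adm: "admissible UNIV (\<lambda>x. int k * tri x)" "admissible UNIV (\<lambda>x. int (2 * k) * tri x)"
    "admissible UNIV (\<lambda>x. int k * x\<^sup>2)"
    using assms by (auto intro!: admissible_tri admissible_square)
  have sq: "psi_series k ^ 2 = theta UNIV ?e (\<lambda>_. 1)"
    unfolding psi_series_def power2_eq_square theta_mult[OF adm(1) adm(1)]
    by (simp add: split_def)
  have adm2: "admissible UNIV ?e"
    using admissible_Times[OF adm(1) adm(1)] by simp
  let ?A = "{p. even (fst p - snd p)} :: (int \<times> int) set"
  have "theta {p \<in> UNIV. \<not> even (fst p - snd p)} ?e (\<lambda>_. 1) = theta ?A ?e (\<lambda>_. 1)"
    by (rule theta_reindex[where h = "\<lambda>(x, y). (x, 1 - y)" and g = "\<lambda>(x, y). (x, 1 - y)"])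
       (auto simp: tri_reflect)
  then have "psi_series k ^ 2 = 2 * theta ?A ?e (\<lambda>_. 1)"
    unfolding sq using theta_split[OF adm2, of "\<lambda>_. 1" "\<lambda>p. even (fst p - snd p)"] by simp
  also have "theta ?A ?e (\<lambda>_. 1) = phi_series k * psi_series (2 * k)"
    unfolding phi_series_def psi_series_def theta_mult[OF adm(3) adm(2)]
  proof (rule theta_reindex[symmetric, where h = "\<lambda>(x, y). (y + x, y - x)" and g = "\<lambda>(x, y). ((x - y) div 2, (x + y) div 2)"])
    fix p :: "int \<times> int"
    obtain x y where p: "p = (x, y)" by fastforce
    have "2 * (tri (y + x) + tri (y - x)) = 2 * (x\<^sup>2 + 2 * tri y)"
      using two_tri[of y] two_tri[of "y + x"] two_tri[of "y - x"] by (simp add: algebra_simps power2_eq_square)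
    then have "tri (y + x) + tri (y - x) = x\<^sup>2 + 2 * tri y" by simp
    then have "int k * tri (y + x) + int k * tri (y - x) = int k * x\<^sup>2 + int (2 * k) * tri y"
      by (simp flip: distrib_left) (simp add: algebra_simps)
    then show "(case p of (x, y) \<Rightarrow> (y + x, y - x)) \<in> ?A \<and>
      (case (case p of (x, y) \<Rightarrow> (y + x, y - x)) of (x, y) \<Rightarrow> ((x - y) div 2, (x + y) div 2)) = p \<and>
      ?e (case p of (x, y) \<Rightarrow> (y + x, y - x)) = (case p of (i, j) \<Rightarrow> int k * i\<^sup>2 + int (2 * k) * tri j) \<and>
      1 = (case p of (i, j) \<Rightarrow> 1 * (1::int))"
      using p by simp
  next
    fix j :: "int \<times> int" assume "j \<in> ?A"
    then obtain r where "fst j - snd j = 2 * r" by (blast elim: evenE)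
    then obtain y where "j = (y + 2 * r, y)"
      by (cases j) (auto simp: algebra_simps)
    then show "(case j of (x, y) \<Rightarrow> ((x - y) div 2, (x + y) div 2)) \<in> UNIV \<times> UNIV \<and>
      (case (case j of (x, y) \<Rightarrow> ((x - y) div 2, (x + y) div 2)) of (x, y) \<Rightarrow> (y + x, y - x)) = j"
      by simp
  qed
  finally show ?thesis .
qed

lemma fps_alt_psi_even:
  assumes "even k"
  shows "fps_alt (psi_series k) = psi_series k" "fps_alt (phi_series k) = phi_series k"
  using assms by (simp_all add: psi_series_def phi_series_def fps_alt_theta)

text \<open>Gauss's phi(-q) = f_1^2 / f_2 without a further triple product: q -> -q in
  \<open>psi_series_square\<close> gives phi(-q) = psi(-q)^2 / psi(q^2), and both psi series are
  known quotients of Euler products.\<close>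

lemma fps_alt_phi_product:
  assumes "k > 0" "odd k"
  shows "fps_alt (phi_series k) * euler_fps (fps_X ^ (2 * k)) = euler_fps (fps_X ^ k) ^ 2"
proof -
  define a where "a = euler_fps (fps_X ^ k :: int fps)"
  define b where "b = euler_fps (- (fps_X ^ k) :: int fps)"
  define c where "c = euler_fps (fps_X ^ (2 * k) :: int fps)"
  define d where "d = euler_fps (fps_X ^ (4 * k) :: int fps)"
  have 1: "fps_alt (psi_series k) * b = 2 * c ^ 2" "a * b * d = c ^ 3" "psi_series (2 * k) * c = 2 * d ^ 2"
    using fps_alt_psi_euler euler_fps_neg_X_power assms psi_series_product[of "2 * k"]
    by (simp_all add: a_def b_def c_def d_def)
  have "fps_alt (psi_series k ^ 2) = fps_alt (2 * (phi_series k * psi_series (2 * k)))"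
    using psi_series_square assms by simp
  then have "fps_alt (psi_series k) ^ 2 = 2 * (fps_alt (phi_series k) * psi_series (2 * k))"
    by (simp add: fps_alt_mult fps_alt_power fps_alt_psi_even)
  then have "2 * (fps_alt (phi_series k) * (psi_series (2 * k) * c)) * (a * b) ^ 2 =
      (fps_alt (psi_series k) * b) ^ 2 * c * a ^ 2"
    by (simp add: power_mult_distrib mult_ac)
  then have "2 * (fps_alt (phi_series k) * (2 * d ^ 2)) * (a * b) ^ 2 = (2 * c ^ 2) ^ 2 * c * a ^ 2"
    unfolding 1 .
  moreover have "2 * (fps_alt (phi_series k) * (2 * d ^ 2)) * (a * b) ^ 2 = 4 * (fps_alt (phi_series k) * (a * b * d) ^ 2)"
    by (simp add: power_mult_distrib mult_ac)
  moreover have "(2 * c ^ 2) ^ 2 * c * a ^ 2 = 4 * (c ^ 5 * a ^ 2)"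
    by (simp add: eval_nat_numeral mult_ac)
  ultimately have "4 * (fps_alt (phi_series k) * (c ^ 3) ^ 2) = 4 * (c ^ 5 * a ^ 2)"
    unfolding 1 by simp
  then have "fps_alt (phi_series k) * (c ^ 3) ^ 2 = c ^ 5 * a ^ 2"
    by (subst (asm) mult_left_cancel) auto
  then have "(fps_alt (phi_series k) * c) * c ^ 5 = a ^ 2 * c ^ 5"
    by (simp add: eval_nat_numeral mult_ac)
  then show ?thesis by (simp add: a_def c_def)
qed

section \<open>Identities from the Eisenstein lattice\<close>

text \<open>For \<open>X\<close>, \<open>Y\<close> odd with \<open>X \<equiv> Y (mod 4)\<close>, the substitution \<open>X = p + 3 r\<close>, \<open>Y = p - r\<close>
  (multiplication by a sixth root of unity in the Eisenstein integers) gives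
  \<open>X^2 + 3 Y^2 = 4 (p^2 + 3 r^2)\<close>, where \<open>p + r\<close> is odd.\<close>
lemma eisenstein_reindex:
  assumes w: "\<And>x y. w (x, 1 - y) = w (x, y)"
    and adm: "admissible UNIV (\<lambda>(x, y). F (tri x + 3 * tri y))"
  shows "theta UNIV (\<lambda>(x, y). F (tri x + 3 * tri y)) w =
    2 * theta {(p, r). odd (p + r)} (\<lambda>(p, r). F ((p\<^sup>2 + 3 * r\<^sup>2 - 1) div 2))
      (\<lambda>(p, r). w ((p + 3 * r + 1) div 2, (p - r + 1) div 2))"
proof -
  let ?e = "\<lambda>(x, y). F (tri x + 3 * tri y)"
  let ?A = "{p. even (fst p - snd p)} :: (int \<times> int) set"
  \<comment> \<open>With X = 2x - 1 and Y = 2y - 1 the reflection is Y -> -Y, which exchanges the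
    classes X = Y and X = -Y modulo 4.\<close>
  have "theta {p \<in> UNIV. \<not> even (fst p - snd p)} ?e w = theta ?A ?e w"
    by (rule theta_reindex[where h = "\<lambda>(x, y). (x, 1 - y)" and g = "\<lambda>(x, y). (x, 1 - y)"])
       (auto simp: tri_reflect w)
  then have "theta UNIV ?e w = 2 * theta ?A ?e w"
    using theta_split[OF adm, of w "\<lambda>p. even (fst p - snd p)"] by simp
  also have "theta ?A ?e w = theta {(p, r). odd (p + r)} (\<lambda>(p, r). F ((p\<^sup>2 + 3 * r\<^sup>2 - 1) div 2))
      (\<lambda>(p, r). w ((p + 3 * r + 1) div 2, (p - r + 1) div 2))"
  proof (rule theta_reindex[where h = "\<lambda>(x, y). ((x - y) div 2 + 2 * y - 1, (x - y) div 2)"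
        and g = "\<lambda>(p, r). ((p + 3 * r + 1) div 2, (p - r + 1) div 2)"])
    fix i :: "int \<times> int" assume "i \<in> ?A"
    then obtain r where "fst i - snd i = 2 * r" by (blast elim: evenE)
    then obtain y where i: "i = (y + 2 * r, y)"
      by (cases i) (auto simp: algebra_simps)
    have "2 * (tri (y + 2 * r) + 3 * tri y) = (r + 2 * y - 1)\<^sup>2 + 3 * r\<^sup>2 - 1"
      using two_tri[of y] two_tri[of "y + 2 * r"] by (simp add: algebra_simps power2_eq_square)
    then have "((r + 2 * y - 1)\<^sup>2 + 3 * r\<^sup>2 - 1) div 2 = tri (y + 2 * r) + 3 * tri y"
      by (simp flip: \<open>2 * _ = _\<close>)
    then show "(case i of (x, y) \<Rightarrow> ((x - y) div 2 + 2 * y - 1, (x - y) div 2)) \<in> {(p, r). odd (p + r)} \<and>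
       (case (case i of (x, y) \<Rightarrow> ((x - y) div 2 + 2 * y - 1, (x - y) div 2)) of (p, r) \<Rightarrow> ((p + 3 * r + 1) div 2, (p - r + 1) div 2)) = i \<and>
       (case (case i of (x, y) \<Rightarrow> ((x - y) div 2 + 2 * y - 1, (x - y) div 2)) of (p, r) \<Rightarrow> F ((p\<^sup>2 + 3 * r\<^sup>2 - 1) div 2)) = ?e i \<and>
       (case (case i of (x, y) \<Rightarrow> ((x - y) div 2 + 2 * y - 1, (x - y) div 2)) of (p, r) \<Rightarrow> w ((p + 3 * r + 1) div 2, (p - r + 1) div 2)) = w i"
      using i by (simp add: add.commute[of y])
  next
    fix j :: "int \<times> int" assume "j \<in> {(p, r). odd (p + r)}"
    then obtain p r where pr: "j = (p, r)" "odd (p + r)" by blast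
    from pr(2) obtain m where "p + r = 2 * m + 1" by (rule oddE)
    then have j: "j = (2 * m + 1 - r, r)" using pr(1) by simp
    have "2 * m + 1 - r + 3 * r + 1 = 2 * (m + r + 1)" "2 * m + 1 - r - r + 1 = 2 * (m - r + 1)"
      by simp_all
    then have "(2 * m + 1 - r + 3 * r + 1) div 2 = m + r + 1" "(2 * m + 1 - r - r + 1) div 2 = m - r + 1"
      by (simp_all only: nonzero_mult_div_cancel_left[of "2::int"] zero_neq_numeral[symmetric] not_False_eq_True)
    then have "(case j of (p, r) \<Rightarrow> ((p + 3 * r + 1) div 2, (p - r + 1) div 2)) = (m + r + 1, m - r + 1)"
      using j by (simp only: case_prod_conv)
    then show "(case j of (p, r) \<Rightarrow> ((p + 3 * r + 1) div 2, (p - r + 1) div 2)) \<in> ?A \<and>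
       (case (case j of (p, r) \<Rightarrow> ((p + 3 * r + 1) div 2, (p - r + 1) div 2)) of (x, y) \<Rightarrow> ((x - y) div 2 + 2 * y - 1, (x - y) div 2)) = j"
      using j by simp
  qed
  finally show ?thesis .
qed

lemma admissible_mono:
  assumes "admissible I e" "J \<subseteq> I" "\<And>j. j \<in> J \<Longrightarrow> 0 \<le> e' j \<and> e j \<le> a * e' j + b" "a \<ge> 0"
  shows "admissible J e'"
  unfolding admissible_def
proof (intro conjI allI ballI)
  fix n
  have "{j \<in> J. e' j \<le> n} \<subseteq> {i \<in> I. e i \<le> a * n + b}"
  proof
    fix j assume j: "j \<in> {j \<in> J. e' j \<le> n}"
    then have "a * e' j \<le> a * n" using assms(4) by (intro mult_left_mono) auto
    then show "j \<in> {i \<in> I. e i \<le> a * n + b}" using j assms(2) assms(3)[of j] by auto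
  qed
  then show "finite {j \<in> J. e' j \<le> n}"
    by (rule finite_subset) (use assms(1) in \<open>auto simp: admissible_def\<close>)
qed (use assms in auto)

lemma admissible_tri_tri: "admissible UNIV (\<lambda>(x, y). tri x + 3 * tri y)"
  using admissible_Times[OF admissible_tri[of 1] admissible_tri[of 3]] by simp

lemma admissible_eisenstein: "admissible UNIV (\<lambda>(x, y). x\<^sup>2 + 3 * y\<^sup>2)"
  using admissible_Times[OF admissible_square[of 1] admissible_square[of 3]] by simp

text \<open>After the Eisenstein substitution the parity of r separates the even from the odd
  exponents: p = 2x - 1, r = 2y gives 4 tri x + 6 y^2, and p = 2x, r = 2y - 1 gives 2 x^2 + 12 tri y
  + 1.\<close>

lemma psi_dissection:
  "psi_series 1 * psi_series 3 = 2 * (psi_series 4 * phi_series 6) + 2 * fps_X * (phi_series 2 * psi_series 12)"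
proof -
  let ?E = "\<lambda>(p, r). (p\<^sup>2 + 3 * r\<^sup>2 - 1) div 2 :: int"
  let ?O = "{(p, r). odd (p + r)} :: (int \<times> int) set"
  have adm: "admissible UNIV (\<lambda>x. int 1 * tri x)" "admissible UNIV (\<lambda>x. int 3 * tri x)"
    "admissible UNIV (\<lambda>x. int 4 * tri x)" "admissible UNIV (\<lambda>x. int 12 * tri x)"
    "admissible UNIV (\<lambda>x. int 2 * x\<^sup>2)" "admissible UNIV (\<lambda>x. int 6 * x\<^sup>2)"
    by (intro admissible_tri admissible_square; simp)+
  have "psi_series 1 * psi_series 3 = theta UNIV (\<lambda>(x, y). tri x + 3 * tri y) (\<lambda>_. 1)"
    unfolding psi_series_def theta_mult[OF adm(1,2)] by (simp add: split_def)
  also have "\<dots> = 2 * theta ?O ?E (\<lambda>_. 1)"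
    using eisenstein_reindex[of "\<lambda>_. 1" "\<lambda>t. t"] admissible_tri_tri by (simp add: split_def)
  also have "theta ?O ?E (\<lambda>_. 1) = theta {i \<in> ?O. even (snd i)} ?E (\<lambda>_. 1) + theta {i \<in> ?O. odd (snd i)} ?E (\<lambda>_. 1)"
  proof (rule theta_split)
    show "admissible ?O ?E"
    proof (rule admissible_mono[OF admissible_eisenstein, where a = 2 and b = 2])
      fix j assume "j \<in> ?O"
      then obtain p r where j: "j = (p, r)" "odd (p + r)" by blast
      \<comment> \<open>Oddness of p + r excludes the origin, where the exponent would be
        -1.\<close>
      then have "p\<^sup>2 + 3 * r\<^sup>2 \<noteq> 0"
        by (auto simp: add_nonneg_eq_0_iff)
      moreover have "0 \<le> p\<^sup>2 + 3 * r\<^sup>2" by simp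
      ultimately have "0 \<le> (p\<^sup>2 + 3 * r\<^sup>2 - 1) div 2 \<and> p\<^sup>2 + 3 * r\<^sup>2 \<le> 2 * ((p\<^sup>2 + 3 * r\<^sup>2 - 1) div 2) + 2"
        by linarith
      then show "0 \<le> ?E j \<and> (case j of (x, y) \<Rightarrow> x\<^sup>2 + 3 * y\<^sup>2) \<le> 2 * ?E j + 2"
        using j by simp
    qed simp_all
  qed
  also have "theta {i \<in> ?O. even (snd i)} ?E (\<lambda>_. 1) = psi_series 4 * phi_series 6"
    unfolding psi_series_def phi_series_def theta_mult[OF adm(3,6)]
  proof (rule theta_reindex[symmetric, where h = "\<lambda>(x, y). (2 * x - 1, 2 * y)" and g = "\<lambda>(p, r). ((p + 1) div 2, r div 2)"])
    fix i :: "int \<times> int"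
    obtain x y where i: "i = (x, y)" by fastforce
    have "(2 * x - 1)\<^sup>2 + 3 * (2 * y)\<^sup>2 - 1 = 2 * (4 * tri x + 6 * y\<^sup>2)"
      using two_tri[of x] by (simp add: power2_eq_square algebra_simps)
    then show "(case i of (x, y) \<Rightarrow> (2 * x - 1, 2 * y)) \<in> {i \<in> ?O. even (snd i)} \<and>
      (case (case i of (x, y) \<Rightarrow> (2 * x - 1, 2 * y)) of (p, r) \<Rightarrow> ((p + 1) div 2, r div 2)) = i \<and>
      ?E (case i of (x, y) \<Rightarrow> (2 * x - 1, 2 * y)) = (case i of (i, j) \<Rightarrow> int 4 * tri i + int 6 * j\<^sup>2) \<and>
      1 = (case i of (i, j) \<Rightarrow> 1 * (1::int))"
      using i by simp
  qed (auto elim!: evenE oddE, presburger?)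
  also have "theta {i \<in> ?O. odd (snd i)} ?E (\<lambda>_. 1) = fps_X * (phi_series 2 * psi_series 12)"
  proof -
    have "fps_X ^ 1 * (phi_series 2 * psi_series 12) =
      theta (UNIV \<times> UNIV) (\<lambda>i. (case i of (i, j) \<Rightarrow> int 2 * i\<^sup>2 + int 12 * tri j) + int 1) (\<lambda>(i, j). 1 * 1)"
      unfolding psi_series_def phi_series_def theta_mult[OF adm(5,4)]
      by (rule theta_shift) (auto simp: tri_nonneg)
    also have "\<dots> = theta {i \<in> ?O. odd (snd i)} ?E (\<lambda>_. 1)"
    proof (rule theta_reindex[where h = "\<lambda>(x, y). (2 * x, 2 * y - 1)" and g = "\<lambda>(p, r). (p div 2, (r + 1) div 2)"])
      fix i :: "int \<times> int"
      obtain x y where i: "i = (x, y)" by fastforce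
      have "(2 * x)\<^sup>2 + 3 * (2 * y - 1)\<^sup>2 - 1 = 2 * (2 * x\<^sup>2 + 12 * tri y + 1)"
        using two_tri[of y] by (simp add: power2_eq_square algebra_simps)
      then show "(case i of (x, y) \<Rightarrow> (2 * x, 2 * y - 1)) \<in> {i \<in> ?O. odd (snd i)} \<and>
        (case (case i of (x, y) \<Rightarrow> (2 * x, 2 * y - 1)) of (p, r) \<Rightarrow> (p div 2, (r + 1) div 2)) = i \<and>
        ?E (case i of (x, y) \<Rightarrow> (2 * x, 2 * y - 1)) = (case i of (i, j) \<Rightarrow> int 2 * i\<^sup>2 + int 12 * tri j) + int 1 \<and>
        1 = (case i of (i, j) \<Rightarrow> 1 * (1::int))"
        using i by simp
    qed (auto elim!: evenE oddE, presburger?)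
    finally show ?thesis by simp
  qed
  finally show ?thesis by (simp add: algebra_simps)
qed

text \<open>The weight is minus the real part of z^2 for z = x + y sqrt(-3). Multiplication by a
  primitive cube root of unity (\<open>g\<close>, with inverse \<open>h\<close>) preserves the
  lattice and the norm, and the squares of the three rotated points sum to 0.\<close>

lemma eisenstein_rotation_sum:
  "theta {(x, y). even (x + y)} (\<lambda>(x, y). x\<^sup>2 + 3 * y\<^sup>2) (\<lambda>(x, y). 3 * y\<^sup>2 - x\<^sup>2) = 0"
proof -
  let ?V = "{(x, y). even (x + y)} :: (int \<times> int) set"
  let ?e = "\<lambda>(x, y). x\<^sup>2 + 3 * y\<^sup>2 :: int"
  let ?f = "\<lambda>(x, y). 3 * y\<^sup>2 - x\<^sup>2 :: int"
  define g where "g = (\<lambda>(x, y). ((- x - 3 * y) div 2, (x - y) div 2) :: int \<times> int)"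
  define h where "h = (\<lambda>(x, y). ((3 * y - x) div 2, (- x - y) div 2) :: int \<times> int)"
  have gh: "g i \<in> ?V \<and> h i \<in> ?V \<and> g (h i) = i \<and> h (g i) = i \<and> ?e (g i) = ?e i \<and> ?e (h i) = ?e i \<and>
    ?f i + ?f (g i) + ?f (h i) = 0" if iV: "i \<in> ?V" for i
  proof -
    obtain x y where xy: "i = (x, y)" "even (x + y)" using iV by blast
    from xy(2) obtain m where "x + y = 2 * m" by (rule evenE)
    then have i: "i = (2 * m - y, y)" using xy(1) by simp
    have g: "g i = (- m - y, m - y)" and h: "h i = (2 * y - m, - m)"
      unfolding i g_def h_def by (simp_all add: algebra_simps)
    have "h (- m - y, m - y) = i" "g (2 * y - m, - m) = i"
      unfolding i g_def h_def by (simp_all add: algebra_simps)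
    then show ?thesis unfolding g h by (simp add: i power2_eq_square algebra_simps)
  qed
  have 1: "theta ?V ?e (\<lambda>i. ?f (g i)) = theta ?V ?e ?f"
    by (rule theta_reindex[where h = g and g = h]) (use gh in auto)
  have 2: "theta ?V ?e (\<lambda>i. ?f (h i)) = theta ?V ?e ?f"
    by (rule theta_reindex[where h = h and g = g]) (use gh in auto)
  have "3 * theta ?V ?e ?f = theta ?V ?e ?f + theta ?V ?e (\<lambda>i. ?f (g i)) + theta ?V ?e (\<lambda>i. ?f (h i))"
    unfolding 1 2 by simp
  also have "\<dots> = theta ?V ?e (\<lambda>i. ?f i + ?f (g i) + ?f (h i))"
    by (simp only: theta_add)
  also have "\<dots> = theta ?V ?e (\<lambda>_. 0)"
    by (rule theta_cong) (use gh in auto)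
  also have "\<dots> = 0" by (rule fps_ext) (simp add: theta_nth)
  finally show ?thesis by simp
qed

text \<open>On the left the weight is 3y^2 - x^2 with sign (-1)^(x+y); the part with x + y even
  vanishes by rotation. On the right the weight XY = (p + 3r)(p - r) is p^2 - 3r^2 + 2pr, whose
  cross term vanishes by symmetry.\<close>

lemma theta_wronskian:
  "2 * (fps_alt (phi_series 1) * (fps_X * fps_deriv (fps_alt (phi_series 3)))
    - fps_X * fps_deriv (fps_alt (phi_series 1)) * fps_alt (phi_series 3))
    = fps_X * (jacobi_series 2 * jacobi_series 6)"
proof -
  let ?e = "\<lambda>(x, y). x\<^sup>2 + 3 * y\<^sup>2 :: int"
  let ?O = "{(p, r). odd (p + r)} :: (int \<times> int) set"
  define v where "v = (\<lambda>x::int. if odd x then 2 * x - 1 else 1 - 2 * x)"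
  have adm: "admissible UNIV (\<lambda>x. int 1 * x\<^sup>2)" "admissible UNIV (\<lambda>x. int 3 * x\<^sup>2)"
    "admissible UNIV (\<lambda>x. int 2 * tri x)" "admissible UNIV (\<lambda>x. int 6 * tri x)"
    by (intro admissible_tri admissible_square; simp)+
  let ?w = "\<lambda>(x, y). if even (x + y) then 3 * y\<^sup>2 - x\<^sup>2 else x\<^sup>2 - 3 * y\<^sup>2 :: int"
  have "fps_alt (phi_series 1) * (fps_X * fps_deriv (fps_alt (phi_series 3)))
    - fps_X * fps_deriv (fps_alt (phi_series 1)) * fps_alt (phi_series 3) = theta UNIV ?e ?w"
    unfolding phi_series_def fps_alt_theta theta_deriv theta_mult[OF adm(1,2)] theta_diff[symmetric]
    by (simp only: UNIV_Times_UNIV, rule theta_cong) auto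
  also have "\<dots> = theta {i \<in> UNIV. even (fst i + snd i)} ?e ?w + theta {i \<in> UNIV. odd (fst i + snd i)} ?e ?w"
    by (rule theta_split[OF admissible_eisenstein])
  also have "theta {i \<in> UNIV. even (fst i + snd i)} ?e ?w = theta {(x, y). even (x + y)} ?e (\<lambda>(x, y). 3 * y\<^sup>2 - x\<^sup>2)"
    by (rule theta_reindex[where h = id and g = id]) auto
  also have "\<dots> = 0" by (rule eisenstein_rotation_sum)
  also have "theta {i \<in> UNIV. odd (fst i + snd i)} ?e ?w = theta ?O ?e (\<lambda>(x, y). x\<^sup>2 - 3 * y\<^sup>2)"
    by (rule theta_reindex[where h = id and g = id]) auto
  finally have lhs: "fps_alt (phi_series 1) * (fps_X * fps_deriv (fps_alt (phi_series 3)))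
    - fps_X * fps_deriv (fps_alt (phi_series 1)) * fps_alt (phi_series 3) = theta ?O ?e (\<lambda>(x, y). x\<^sup>2 - 3 * y\<^sup>2)"
    by simp
  have "fps_X ^ 1 * (jacobi_series 2 * jacobi_series 6) = theta UNIV (\<lambda>(x, y). 2 * (tri x + 3 * tri y) + 1) (\<lambda>(x, y). v x * v y)"
    unfolding jacobi_series_def theta_mult[OF adm(3,4)] v_def
    by (subst theta_shift) (auto simp: tri_nonneg intro!: theta_cong)
  \<comment> \<open>Taking \<open>F\<close> as t -> 2t + 1 makes the new exponent p^2 + 3r^2 itself,
    as this is odd on the index set.\<close>
  also have "\<dots> = 2 * theta ?O (\<lambda>(p, r). 2 * ((p\<^sup>2 + 3 * r\<^sup>2 - 1) div 2) + 1)
      (\<lambda>(p, r). v ((p + 3 * r + 1) div 2) * v ((p - r + 1) div 2))"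
  proof (subst eisenstein_reindex[where F = "\<lambda>t. 2 * t + 1"])
    show "admissible UNIV (\<lambda>(x, y). 2 * (tri x + 3 * tri y) + 1)"
      by (rule admissible_mono[OF admissible_tri_tri, where a = 1 and b = 0]) (auto simp: tri_nonneg)
  qed (auto simp: v_def intro!: theta_cong)
  also have "theta ?O (\<lambda>(p, r). 2 * ((p\<^sup>2 + 3 * r\<^sup>2 - 1) div 2) + 1)
      (\<lambda>(p, r). v ((p + 3 * r + 1) div 2) * v ((p - r + 1) div 2)) =
     theta ?O ?e (\<lambda>i. (case i of (x, y) \<Rightarrow> x\<^sup>2 - 3 * y\<^sup>2) + (case i of (x, y) \<Rightarrow> 2 * x * y))"
  proof (rule theta_cong)
    fix i assume "i \<in> ?O"
    then obtain p r where pr: "i = (p, r)" "odd (p + r)" by blast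
    from pr(2) obtain m where "p + r = 2 * m + 1" by (rule oddE)
    then have i: "i = (2 * m + 1 - r, r)" using pr(1) by simp
    have "odd ((2 * m + 1 - r)\<^sup>2 + 3 * r\<^sup>2)" by simp
    then show "(case i of (p, r) \<Rightarrow> 2 * ((p\<^sup>2 + 3 * r\<^sup>2 - 1) div 2) + 1) = ?e i"
      unfolding i by (auto elim!: oddE)
    have "(2 * m + 1 - r + 3 * r + 1) div 2 = m + r + 1" "(2 * m + 1 - r - r + 1) div 2 = m - r + 1"
      by simp_all
    \<comment> \<open>The two arguments have the same parity, so the signs in \<open>v\<close>
      cancel.\<close>
    moreover have "v (m + r + 1) * v (m - r + 1) = (2 * m + 2 * r + 1) * (2 * m - 2 * r + 1)"
      by (auto simp: v_def algebra_simps)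
    ultimately show "(case i of (p, r) \<Rightarrow> v ((p + 3 * r + 1) div 2) * v ((p - r + 1) div 2)) =
      (case i of (x, y) \<Rightarrow> x\<^sup>2 - 3 * y\<^sup>2) + (case i of (x, y) \<Rightarrow> 2 * x * y)"
      unfolding i by (simp add: power2_eq_square algebra_simps)
  qed
  also have "\<dots> = theta ?O ?e (\<lambda>(x, y). x\<^sup>2 - 3 * y\<^sup>2) + theta ?O ?e (\<lambda>(x, y). 2 * x * y)"
    by (rule theta_add)
  \<comment> \<open>The weight is odd under y -> -y, while exponent and index set are
    invariant.\<close>
  also have "theta ?O ?e (\<lambda>(x, y). 2 * x * y) = 0"
  proof -
    have "theta ?O ?e (\<lambda>(x, y). 2 * x * y) = theta ?O ?e (\<lambda>i. - (case i of (x, y) \<Rightarrow> 2 * x * y))"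
      by (rule theta_reindex[where h = "\<lambda>(x, y). (x, - y)" and g = "\<lambda>(x, y). (x, - y)"]) auto
    then show ?thesis unfolding theta_uminus by (simp add: eq_neg_iff_add_eq_0)
  qed
  finally show ?thesis unfolding lhs by simp
qed

section \<open>Logarithmic derivatives\<close>

text \<open>This is -D f_k / f_k, as \<open>euler_fps_deriv\<close> shows.\<close>

definition sigma_series :: "nat \<Rightarrow> int fps" where
  "sigma_series k = Abs_fps (\<lambda>n. if n > 0 \<and> k dvd n then int (k * sigma_div (n div k)) else 0)"

definition multiples_series :: "nat \<Rightarrow> int fps" where
  "multiples_series m = Abs_fps (\<lambda>n. if n > 0 \<and> m dvd n then 1 else 0)"

lemma multiples_series_eq:
  assumes "m > 0"
  shows "(1 - fps_X ^ m) * multiples_series m = fps_X ^ m"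
proof (rule fps_ext)
  fix n
  have "m dvd n - m \<longleftrightarrow> m dvd n" if "m \<le> n" using that by (simp add: dvd_minus_self)
  then show "fps_nth ((1 - fps_X ^ m) * multiples_series m) n = fps_nth (fps_X ^ m :: int fps) n"
    using assms by (auto simp: left_diff_distrib fps_X_power_mult_nth multiples_series_def fps_X_power_nth dest: dvd_imp_le)
qed

lemma fps_X_power_dvd_deriv:
  fixes f :: "'a::comm_ring_1 fps"
  assumes "fps_X ^ n dvd f"
  shows "fps_X ^ n dvd fps_X * fps_deriv f"
  using assms unfolding fps_X_power_dvd_iff by (auto simp: fps_X_mult_nth)

text \<open>Each factor 1 - q^m contributes its logarithmic derivative -m q^m / (1 - q^m), the
  quotient being expanded as \<open>multiples_series m\<close>.\<close>

lemma euler_poly_deriv: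
  assumes "k > 0"
  shows "fps_X * fps_deriv (euler_poly (fps_X ^ k) n) =
    - (euler_poly (fps_X ^ k) n * (\<Sum>s<n. of_nat (k * Suc s) * multiples_series (k * Suc s)))"
proof (induction n)
  case 0
  then show ?case by simp
next
  case (Suc n)
  let ?m = "k * Suc n"
  have m: "?m > 0" using assms by simp
  have X: "fps_X * fps_deriv (fps_X ^ m) = (of_nat m * fps_X ^ m :: int fps)" for m
  proof (cases m)
    case (Suc j)
    then show ?thesis
      using fps_deriv_power[of "fps_X :: int fps" m] by (simp add: fps_of_nat mult_ac fps_const_add[symmetric] del: fps_const_add)
  qed simp
  have "fps_X * fps_deriv (euler_poly (fps_X ^ k) (Suc n)) =
    (fps_X * fps_deriv (euler_poly (fps_X ^ k) n)) * (1 - fps_X ^ ?m)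
     - euler_poly (fps_X ^ k) n * (fps_X * fps_deriv (fps_X ^ ?m :: int fps))"
    by (simp only: euler_poly_Suc power_mult[symmetric] fps_deriv_mult fps_deriv_sub fps_deriv_1 diff_0 ring_distribs mult_ac mult_minus_right)
       simp
  also have "\<dots> = - (euler_poly (fps_X ^ k) (Suc n) * (\<Sum>s<Suc n. of_nat (k * Suc s) * multiples_series (k * Suc s)))"
    unfolding Suc.IH X
    by (subst (2) multiples_series_eq[OF m, symmetric])
       (simp only: euler_poly_Suc power_mult[symmetric] sum.lessThan_Suc ring_distribs mult_ac minus_mult_left[symmetric] minus_add_distrib, simp add: algebra_simps)
  finally show ?case .
qed

text \<open>A Lambert series: the coefficient at i collects the divisors of i that are multiples of
  k, and for i < n all of them occur with s < n.\<close>

lemma sigma_series_cong: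
  assumes "k > 0"
  shows "fps_X ^ n dvd sigma_series k - (\<Sum>s<n. of_nat (k * Suc s) * multiples_series (k * Suc s))"
  unfolding fps_X_power_dvd_iff
proof (intro allI impI)
  fix i assume i: "i < n"
  have "fps_nth (\<Sum>s<n. of_nat (k * Suc s) * multiples_series (k * Suc s)) i
    = (\<Sum>s<n. if i > 0 \<and> k * Suc s dvd i then int (k * Suc s) else 0)"
    unfolding fps_sum_nth by (intro sum.cong refl) (simp only: fps_mult_of_nat_nth multiples_series_def fps_nth_Abs_fps, simp)
  also have "\<dots> = (if i > 0 \<and> k dvd i then int (k * sigma_div (i div k)) else 0)"
  proof (cases "i > 0 \<and> k dvd i")
    case True
    then obtain j where j: "i = k * j" by auto
    have "(\<Sum>s<n. if i > 0 \<and> k * Suc s dvd i then int (k * Suc s) else 0)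
      = (\<Sum>s | s \<in> {..<n} \<and> Suc s dvd j. int (k * Suc s))"
      using True assms unfolding j by (subst sum.inter_filter) (simp_all del: mult_Suc_right)
    also have "\<dots> = (\<Sum>d | d dvd j. int (k * d))"
    proof (rule sum.reindex_bij_witness[where j = Suc and i = "\<lambda>d. d - 1"])
      fix d assume d: "d \<in> {d. d dvd j}"
      then have "d > 0" "d \<le> j" using True j by (auto intro: dvd_imp_le Nat.gr0I)
      moreover have "j \<le> i" using j assms by simp
      ultimately show "d - 1 \<in> {s \<in> {..<n}. Suc s dvd j}" "Suc (d - 1) = d" using i d by auto
    qed auto
    also have "\<dots> = int (k * sigma_div (i div k))"
      using j assms by (simp add: sigma_div_def sum_distrib_left)
    finally show ?thesis using True by simp
  next
    case False
    then show ?thesis using dvd_mult_left by (intro sum.neutral[THEN trans]) auto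
  qed
  finally show "fps_nth (sigma_series k - (\<Sum>s<n. of_nat (k * Suc s) * multiples_series (k * Suc s))) i = 0"
    by (simp only: fps_sub_nth sigma_series_def fps_nth_Abs_fps diff_self)
qed

lemma euler_fps_deriv:
  assumes "k > 0"
  shows "fps_X * fps_deriv (euler_fps (fps_X ^ k)) = - (euler_fps (fps_X ^ k) * sigma_series k)"
proof (rule fps_eqI_cong)
  fix n
  let ?q = "fps_X ^ k :: int fps"
  let ?S = "\<Sum>s<n. of_nat (k * Suc s) * multiples_series (k * Suc s)"
  have c: "fps_X ^ n dvd euler_fps ?q - euler_poly ?q n"
    by (intro euler_fps_cong_poly fps_X_dvd_power assms order_refl)
  have "fps_X ^ n dvd fps_X * fps_deriv (euler_fps ?q) - fps_X * fps_deriv (euler_poly ?q n)"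
    using fps_X_power_dvd_deriv[OF c] by (simp add: algebra_simps)
  moreover have "fps_X ^ n dvd euler_fps ?q * sigma_series k - euler_poly ?q n * ?S"
    by (intro dvd_diff_mult c sigma_series_cong assms)
  ultimately have "fps_X ^ n dvd (fps_X * fps_deriv (euler_fps ?q) - fps_X * fps_deriv (euler_poly ?q n))
      + (euler_fps ?q * sigma_series k - euler_poly ?q n * ?S)"
    by (rule dvd_add)
  then show "fps_X ^ n dvd fps_X * fps_deriv (euler_fps ?q) - - (euler_fps ?q * sigma_series k)"
    unfolding euler_poly_deriv[OF assms] by simp
qed

text \<open>Logarithmic differentiation of phi(-q) = f_1^2 / f_2, after clearing the
  denominator.\<close>

lemma fps_alt_phi_deriv:
  assumes "k > 0" "odd k"
  shows "fps_X * fps_deriv (fps_alt (phi_series k)) =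
    fps_alt (phi_series k) * (sigma_series (2 * k) - 2 * sigma_series k)"
proof -
  define a where "a = fps_alt (phi_series k)"
  define f where "f = euler_fps (fps_X ^ k :: int fps)"
  define c where "c = euler_fps (fps_X ^ (2 * k) :: int fps)"
  have ac: "a * c = f ^ 2"
    using fps_alt_phi_product assms by (simp add: a_def f_def c_def)
  have f: "fps_X * fps_deriv f = - (f * sigma_series k)"
    and c: "fps_X * fps_deriv c = - (c * sigma_series (2 * k))"
    using euler_fps_deriv[of k] euler_fps_deriv[of "2 * k"] assms by (simp_all add: f_def c_def)
  have "fps_X * fps_deriv (a * c) = 2 * f * (fps_X * fps_deriv f)"
    unfolding ac power2_eq_square by (simp add: algebra_simps)
  then have "(fps_X * fps_deriv a) * c + a * (fps_X * fps_deriv c) = 2 * f * (fps_X * fps_deriv f)"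
    by (simp add: algebra_simps)
  then have "(fps_X * fps_deriv a) * c = a * c * sigma_series (2 * k) - 2 * f ^ 2 * sigma_series k"
    unfolding f c by (simp add: power2_eq_square algebra_simps)
  then have "(fps_X * fps_deriv a) * c = (a * (sigma_series (2 * k) - 2 * sigma_series k)) * c"
    unfolding ac[symmetric] by (simp add: algebra_simps)
  then show ?thesis by (simp add: a_def c_def)
qed

text \<open>In terms of Euler products (f_1^2 / f_2) (f_2^2 / f_1)^2 = f_2^3, which Jacobi's
  identity expands.\<close>

lemma fps_alt_phi_psi_square:
  assumes "k > 0" "odd k"
  shows "fps_alt (phi_series k) * psi_series k ^ 2 = 2 * jacobi_series (2 * k)"
proof -
  define a where "a = fps_alt (phi_series k)"
  define f where "f = euler_fps (fps_X ^ k :: int fps)"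
  define c where "c = euler_fps (fps_X ^ (2 * k) :: int fps)"
  have 1: "a * c = f ^ 2" "psi_series k * f = 2 * c ^ 2" "jacobi_series (2 * k) = 2 * c ^ 3"
    using fps_alt_phi_product psi_series_product jacobi_series_product assms by (simp_all add: a_def f_def c_def)
  have "(a * psi_series k ^ 2) * (c * f ^ 2) = (a * c) * (psi_series k * f) ^ 2"
    by (simp only: power_mult_distrib mult_ac)
  also have "\<dots> = (2 * jacobi_series (2 * k)) * (c * f ^ 2)"
    unfolding 1 by (simp add: eval_nat_numeral mult_ac)
  finally show ?thesis by (simp add: a_def c_def f_def)
qed

text \<open>Dividing the Wronskian of a and b by a b leaves D b / b - D a / a, a combination of
  divisor-sum series.\<close>

lemma psi_squares_eq_sigma:
  "fps_X * (psi_series 1 * psi_series 3) ^ 2 =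
    8 * (2 * sigma_series 1 - sigma_series 2 - 2 * sigma_series 3 + sigma_series 6)"
proof -
  define a where "a = fps_alt (phi_series 1)"
  define b where "b = fps_alt (phi_series 3)"
  have ab: "a * psi_series 1 ^ 2 = 2 * jacobi_series 2" "b * psi_series 3 ^ 2 = 2 * jacobi_series 6"
    using fps_alt_phi_psi_square[of 1] fps_alt_phi_psi_square[of 3] by (simp_all add: a_def b_def)
  have D: "fps_X * fps_deriv a = a * (sigma_series 2 - 2 * sigma_series 1)"
    "fps_X * fps_deriv b = b * (sigma_series 6 - 2 * sigma_series 3)"
    using fps_alt_phi_deriv[of 1] fps_alt_phi_deriv[of 3] by (simp_all add: a_def b_def)
  have nz: "a * b \<noteq> 0"
  proof -
    have "a * euler_fps (fps_X ^ 2) = euler_fps (fps_X ^ 1) ^ 2" "b * euler_fps (fps_X ^ 6) = euler_fps (fps_X ^ 3) ^ 2"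
      using fps_alt_phi_product[of 1] fps_alt_phi_product[of 3] by (simp_all add: a_def b_def)
    then show ?thesis by auto
  qed
  have "(a * b) * (fps_X * (psi_series 1 * psi_series 3) ^ 2) =
    fps_X * ((a * psi_series 1 ^ 2) * (b * psi_series 3 ^ 2))"
    by (simp only: power_mult_distrib mult_ac)
  also have "\<dots> = 4 * (fps_X * (jacobi_series 2 * jacobi_series 6))"
    unfolding ab by simp
  also have "\<dots> = 8 * (a * (fps_X * fps_deriv b) - fps_X * fps_deriv a * b)"
    unfolding theta_wronskian[symmetric] by (simp add: a_def b_def)
  also have "\<dots> = (a * b) * (8 * (2 * sigma_series 1 - sigma_series 2 - 2 * sigma_series 3 + sigma_series 6))"
    unfolding D by (simp add: algebra_simps)
  finally show ?thesis using mult_left_cancel[OF nz] by blast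
qed

text \<open>Three times the divisor sum of N/3 is the sum of the divisors of N that are multiples of
  3; the remaining ones are the divisors of m.\<close>

lemma sigma_div_3_free_part:
  fixes N m b :: nat
  assumes "N = 3 ^ b * m" "m > 0" "\<not> 3 dvd m"
  shows "int (sigma_div N) - (if 3 dvd N then 3 * int (sigma_div (N div 3)) else 0) = int (sigma_div m)"
proof -
  have N: "N > 0" using assms by simp
  have fin: "finite {d. d dvd N}" using N by simp
  have m: "{d. d dvd N \<and> \<not> 3 dvd d} = {d. d dvd m}"
  proof (intro Collect_cong iffI conjI)
    fix d assume d: "d dvd N \<and> \<not> 3 dvd d"
    then have "coprime 3 d" by (intro prime_imp_coprime) auto
    then have "coprime d (3 ^ b)" by (simp add: coprime_commute)
    then show "d dvd m" using d assms(1) by (metis coprime_dvd_mult_right_iff)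
  next
    fix d assume "d dvd m"
    then show "d dvd N" "\<not> 3 dvd d" using assms dvd_trans by auto
  qed
  have three: "(\<Sum>d | d dvd N \<and> 3 dvd d. d) = (if 3 dvd N then 3 * sigma_div (N div 3) else 0)"
  proof (cases "3 dvd N")
    case True
    then obtain M where M: "N = 3 * M" by auto
    have "(\<Sum>d | d dvd N \<and> 3 dvd d. d) = (\<Sum>d | d dvd M. 3 * d)"
      by (rule sum.reindex_bij_witness[where i = "\<lambda>d. 3 * d" and j = "\<lambda>d. d div 3"]) (auto simp: M)
    then show ?thesis using M by (simp add: sigma_div_def sum_distrib_left)
  next
    case False
    then have "{d. d dvd N \<and> 3 dvd d} = {}" using dvd_trans by blast
    then show ?thesis using False by (simp only: sum.empty if_False)
  qed
  have "sigma_div N = (\<Sum>d | d dvd N \<and> 3 dvd d. d) + (\<Sum>d | d dvd N \<and> \<not> 3 dvd d. d)"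
    unfolding sigma_div_def using fin
    by (subst sum.union_disjoint[symmetric]) (auto intro: sum.cong elim: rev_finite_subset)
  then show ?thesis unfolding m three by (auto simp: sigma_div_def)
qed

text \<open>At odd N the series for k = 2 and k = 6 have coefficient 0, which leaves sigma(N) - 3
  sigma(N/3).\<close>

lemma psi_squares_nth:
  assumes "odd N" "N = 3 ^ b * m" "m > 0" "\<not> 3 dvd m"
  shows "fps_nth (fps_X * (psi_series 1 * psi_series 3) ^ 2) N = 16 * int (sigma_div m)"
proof -
  have nd: "\<not> 2 dvd N" "\<not> 6 dvd N" "N > 0" using assms(1) by (auto intro: Nat.gr0I dest: dvd_trans[of 2 6])
  have "fps_nth (fps_X * (psi_series 1 * psi_series 3) ^ 2) N =
    8 * (2 * int (sigma_div N) - 2 * (if 3 dvd N then 3 * int (sigma_div (N div 3)) else 0))"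
    unfolding psi_squares_eq_sigma using nd
    by (simp add: numeral_fps_const sigma_series_def)
  then show ?thesis using sigma_div_3_free_part[OF assms(2-4)] by simp
qed

section \<open>The eta product in terms of Euler products and psi\<close>

lemma eta_prod_eq:
  "(\<Prod>k. eta_factor (Suc k) (fps_X :: int fps)) =
    euler_fps (fps_X ^ 2) * euler_fps (fps_X ^ 4) * euler_fps (fps_X ^ 6) * euler_fps (fps_X ^ 12)"
proof (rule fps_ext)
  fix n
  let ?F = "euler_fps (fps_X ^ 2) * euler_fps (fps_X ^ 4) * euler_fps (fps_X ^ 6) * euler_fps (fps_X ^ 12) :: int fps"
  have fin: "(\<Prod>k<N. eta_factor (Suc k) (fps_X :: int fps)) =
    euler_poly (fps_X ^ 2) N * euler_poly (fps_X ^ 4) N * euler_poly (fps_X ^ 6) N * euler_poly (fps_X ^ 12) N" for N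
    by (simp only: euler_poly_def eta_factor_def prod.distrib power_mult)
  have "fps_X ^ Suc n dvd (\<Prod>k<N. eta_factor (Suc k) fps_X) - ?F" if "N \<ge> Suc n" for N
    unfolding fin using that by (intro dvd_diff_mult euler_poly_cong_fps fps_X_dvd_power) auto
  then have "fps_nth (\<Prod>k<N. eta_factor (Suc k) fps_X) n = fps_nth ?F n" if "N \<ge> Suc n" for N
    using that unfolding fps_X_power_dvd_iff by force
  moreover have "\<forall>\<^sub>F N in sequentially. fps_nth (\<Prod>k<N. eta_factor (Suc k) (fps_X :: int fps)) n =
      fps_nth (\<Prod>k. eta_factor (Suc k) fps_X) n"
    using eta_factor_fps_has_prod(2) unfolding tendsto_fps_iff by blast
  then obtain N0 where "\<And>N. N \<ge> N0 \<Longrightarrow> fps_nth (\<Prod>k<N. eta_factor (Suc k) (fps_X :: int fps)) n =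
      fps_nth (\<Prod>k. eta_factor (Suc k) fps_X) n"
    unfolding eventually_sequentially by blast
  ultimately show "fps_nth (\<Prod>k. eta_factor (Suc k) fps_X) n = fps_nth ?F n"
    by (metis max.cobounded1 max.cobounded2)
qed

lemma eta_prod_eq_psi:
  "16 * (\<Prod>k. eta_factor (Suc k) (fps_X :: int fps)) =
    (psi_series 1 * psi_series 3) * fps_alt (psi_series 1 * psi_series 3)"
proof -
  have "16 * (\<Prod>k. eta_factor (Suc k) (fps_X :: int fps)) =
    (4 * (euler_fps (fps_X ^ 2) * euler_fps (fps_X ^ 4))) * (4 * (euler_fps (fps_X ^ 6) * euler_fps (fps_X ^ 12)))"
    unfolding eta_prod_eq by simp
  also have "\<dots> = (psi_series 1 * fps_alt (psi_series 1)) * (psi_series 3 * fps_alt (psi_series 3))"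
    using psi_series_mult_alt[of 1] psi_series_mult_alt[of 3] by simp
  finally show ?thesis unfolding fps_alt_mult by (simp only: mult_ac)
qed

section \<open>Counting\<close>

text \<open>The identities 2(x+y-1)^2 + 2(x-y)^2 = 8 tri x + 8 tri y + 2 and tri(z+2w-1) +
  tri(z-2w+1) = 2 tri z + (2w-1)^2 turn representations of n into solutions for 8n + 14. These are
  the solutions with u - v even, half of all.\<close>

lemma t_rep_1_1_3_12:
  "2 * int (t_rep 1 1 3 12 n) = fps_nth ((phi_series 2 * psi_series 12) ^ 2) (8 * n + 14)"
proof -
  define S where "S = {((x, u), (y, v)). 2 * x\<^sup>2 + 12 * tri u + (2 * y\<^sup>2 + 12 * tri v) = 8 * int n + 14}"
  define T where "T = {(x, y, z, w). int n = tri x + tri y + 3 * tri z + 12 * tri w}"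
  define A where "A = {p \<in> S. even (snd (fst p) - snd (snd p))}"
  have adm: "admissible UNIV (\<lambda>x. int 12 * tri x)" "admissible UNIV (\<lambda>x. int 2 * x\<^sup>2)"
    by (intro admissible_tri admissible_square; simp)+
  note adm2 = admissible_Times[OF adm(2,1)]
  have S_eq: "S = {p. p \<in> (UNIV \<times> UNIV) \<times> (UNIV \<times> UNIV) \<and>
      (case p of (i, j) \<Rightarrow> (case i of (x, u) \<Rightarrow> int 2 * x\<^sup>2 + int 12 * tri u) + (case j of (x, u) \<Rightarrow> int 2 * x\<^sup>2 + int 12 * tri u))
       = int (8 * n + 14)}"
    by (auto simp: S_def)
  have fin: "finite S"
    unfolding S_eq by (rule admissible_finite[OF admissible_Times[OF adm2 adm2]])
  have "fps_nth ((phi_series 2 * psi_series 12) ^ 2) (8 * n + 14) = (\<Sum>p\<in>S. 1)"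
    unfolding power2_eq_square[of "phi_series 2 * psi_series 12"]
    unfolding phi_series_def psi_series_def theta_mult[OF adm(2,1)] theta_mult[OF adm2 adm2] theta_nth
    by (rule sum.cong) (auto simp: S_def)
  then have nth: "fps_nth ((phi_series 2 * psi_series 12) ^ 2) (8 * n + 14) = int (card S)"
    by simp
  have "A \<subseteq> S" by (auto simp: A_def)
  then have "card S = card A + card (S - A)"
    using fin by (simp add: card_Diff_subset card_mono finite_subset)
  \<comment> \<open>The reflection v -> 1 - v fixes tri v and flips the parity of u - v.\<close>
  also have "card (S - A) = card A"
  proof (rule bij_betw_same_card[OF bij_betw_byWitness[where f' = "\<lambda>(i, (y, v)). (i, (y, 1 - v))"]])
    show "(\<lambda>(i, (y, v)). (i, (y, 1 - v))) ` (S - A) \<subseteq> A" "(\<lambda>(i, (y, v)). (i, (y, 1 - v))) ` A \<subseteq> S - A"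
      by (auto simp: A_def S_def tri_reflect)
  qed auto
  also have "card A = card T"
  proof (rule bij_betw_same_card[OF bij_betw_byWitness[where
        f = "\<lambda>((x, u), (y, v)). ((x + y + 1) div 2, (x - y + 1) div 2, (u + v) div 2, ((u - v) div 2 + 1) div 2)"
        and f' = "\<lambda>(x, y, z, w). ((x + y - 1, z + 2 * w - 1), (x - y, z - 2 * w + 1))"]])
    let ?f = "\<lambda>((x, u), (y, v)). ((x + y + 1) div 2, (x - y + 1) div 2, (u + v) div 2, ((u - v) div 2 + 1) div 2) :: int \<times> int \<times> int \<times> int"
    let ?g = "\<lambda>(x, y, z, w). ((x + y - 1, z + 2 * w - 1), (x - y, z - 2 * w + 1)) :: (int \<times> int) \<times> (int \<times> int)"
    have g: "?g p \<in> A \<longleftrightarrow> p \<in> T" and fg: "?f (?g p) = p" for p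
    proof -
      obtain x y z w where p: "p = (x, y, z, w)" by (cases p) auto
      have "2 * (x + y - 1)\<^sup>2 + 12 * tri (z + 2 * w - 1) + (2 * (x - y)\<^sup>2 + 12 * tri (z - 2 * w + 1))
        = 8 * (tri x + tri y + 3 * tri z + 12 * tri w) + 14"
        using two_tri[of x] two_tri[of y] two_tri[of z] two_tri[of w] two_tri[of "z + 2 * w - 1"] two_tri[of "z - 2 * w + 1"]
        by (simp add: power2_eq_square algebra_simps)
      then show "?g p \<in> A \<longleftrightarrow> p \<in> T" unfolding p A_def S_def T_def by auto
      show "?f (?g p) = p" unfolding p by simp
    qed
    have A: "\<exists>q. p = ?g q" if "p \<in> A" for p
    proof -
      obtain x u y v where p: "p = ((x, u), (y, v))" by (cases p) auto
      have "even (u - v)" using that p by (simp add: A_def)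
      then obtain k where "u - v = 2 * k" by (rule evenE)
      then have u: "u = v + 2 * k" by simp
      have eq: "2 * x\<^sup>2 + 12 * tri u + (2 * y\<^sup>2 + 12 * tri v) = 8 * int n + 14"
        using that p by (simp add: A_def S_def)
      have "tri u + tri v = 2 * tri (v + k) + k\<^sup>2"
        using two_tri[of u] two_tri[of v] two_tri[of "v + k"] unfolding u
        by (simp add: power2_eq_square algebra_simps)
      with eq have eq': "x\<^sup>2 + y\<^sup>2 + 12 * tri (v + k) + 6 * k\<^sup>2 = 4 * int n + 7" by simp
      then have "x\<^sup>2 + y\<^sup>2 = 2 * (2 * int n + 3 - 6 * tri (v + k) - 3 * k\<^sup>2) + 1" by simp
      then have "odd (x\<^sup>2 + y\<^sup>2)" by (rule ssubst) simp
      then have "odd (x + y)" by simp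
      then obtain a where a: "x + y = 2 * a + 1" by (rule oddE)
      then have y: "y = 2 * a + 1 - x" by simp
      \<comment> \<open>As x + y is odd, x^2 + y^2 is 1 modulo 4, whereas 4n + 7 is 3; so 6 k^2
        cannot be divisible by 4.\<close>
      have "odd k"
      proof
        assume "even k"
        then obtain l where "k = 2 * l" by (rule evenE)
        then have "2 * (x * x - 2 * a * x - x) + 4 * a * a + 4 * a + 1 + 12 * tri (v + k) + 24 * l * l = 4 * int n + 7"
          using eq' unfolding y by (simp add: power2_eq_square algebra_simps)
        moreover have "even (x * x - 2 * a * x - x)" by simp
        then obtain b where "x * x - 2 * a * x - x = 2 * b" by (rule evenE)
        ultimately have "2 * (b + a * a + a + 3 * tri (v + k) + 6 * l * l - int n) = 3"
          by (simp add: algebra_simps)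
        then have "even (3 :: int)" by (metis dvd_triv_left)
        then show False by simp
      qed
      then obtain l where l: "k = 2 * l + 1" by (rule oddE)
      have "p = ?g (a + 1, x - a, v + k, l + 1)"
        unfolding p u y l by simp
      then show ?thesis by blast
    qed
    show "\<forall>p\<in>A. ?g (?f p) = p"
    proof
      fix p assume "p \<in> A"
      then obtain q where q: "p = ?g q" using A by blast
      show "?g (?f p) = p" unfolding q fg ..
    qed
    show "?f ` A \<subseteq> T"
    proof
      fix t assume "t \<in> ?f ` A"
      then obtain p where p: "p \<in> A" "t = ?f p" by blast
      then obtain q where q: "p = ?g q" using A by blast
      have "t = q" unfolding p(2) q fg ..
      then show "t \<in> T" using p(1) q g by simp
    qed
    show "\<forall>t\<in>T. ?f (?g t) = t" using fg by blast
    show "?g ` T \<subseteq> A" using g by blast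
  qed
  finally have "card S = 2 * card T" by simp
  moreover have "t_rep 1 1 3 12 n = card T"
    unfolding t_rep_def T_def tri_def by (simp add: mult_ac)
  ultimately show ?thesis using nth by simp
qed

section \<open>Comparison of coefficients at 8n + 17\<close>

theorem theorem4p6:
  fixes n n1 \<beta> :: nat
  assumes "n > 0"
    and "n1 > 0"
    and "8 * n + 17 = 3 ^ \<beta> * n1"
    and "\<not> 3 dvd n1"
  shows "int (t_rep 1 1 3 12 n) = int (sigma_div n1) - eta_coeff (8 * n + 17)"
proof -
  \<comment> \<open>As \<open>psi_series\<close> is doubled, \<open>P\<close> and \<open>Q\<close>
    are twice the series of the same names in the introduction; this accounts for the factors 16
    below.\<close>
  define P where "P = psi_series 4 * phi_series 6"
  define Q where "Q = phi_series 2 * psi_series 12"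
  define F where "F = (\<Prod>k. eta_factor (Suc k) (fps_X :: int fps))"
  let ?N = "8 * n + 17"
  have alt: "fps_alt P = P" "fps_alt Q = Q"
    by (simp_all add: P_def Q_def fps_alt_mult fps_alt_psi_even)
  have psi: "psi_series 1 * psi_series 3 = 2 * P + 2 * fps_X * Q"
    unfolding P_def Q_def by (rule psi_dissection)
  have F: "16 * F = (2 * P + 2 * fps_X * Q) * (2 * P - 2 * fps_X * Q)"
    unfolding F_def eta_prod_eq_psi psi by (simp add: fps_alt_add fps_alt_mult alt)
  have "fps_X * (psi_series 1 * psi_series 3) ^ 2 - 16 * (fps_X * F) = fps_X * ((2 * P + 2 * fps_X * Q) ^ 2 - 16 * F)"
    unfolding psi by (simp add: algebra_simps)
  also have "\<dots> = 8 * (fps_X ^ 2 * (P * Q)) + 8 * (fps_X ^ 3 * Q ^ 2)"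
    unfolding F by (simp add: power2_eq_square power3_eq_cube algebra_simps)
  finally have "fps_nth (fps_X * (psi_series 1 * psi_series 3) ^ 2 - 16 * (fps_X * F)) ?N =
    fps_nth (8 * (fps_X ^ 2 * (P * Q)) + 8 * (fps_X ^ 3 * Q ^ 2)) ?N"
    by simp
  moreover have "fps_nth (fps_X * (psi_series 1 * psi_series 3) ^ 2) ?N = 16 * int (sigma_div n1)"
    by (rule psi_squares_nth[OF _ assms(3,2,4)]) simp
  moreover have "fps_nth (16 * (fps_X * F)) ?N = 16 * eta_coeff ?N"
    by (simp add: eta_coeff_def F_def numeral_fps_const)
  \<comment> \<open>The product of two even series has no odd coefficients, so only the term with
    \<open>Q ^ 2\<close> survives.\<close>
  moreover have "fps_nth (P * Q) (8 * n + 15) = 0"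
  proof -
    have "fps_nth (fps_alt (P * Q)) (8 * n + 15) = fps_nth (P * Q) (8 * n + 15)"
      by (simp add: fps_alt_mult alt)
    then show ?thesis by (simp add: fps_alt_nth)
  qed
  then have "fps_nth (8 * (fps_X ^ 2 * (P * Q)) + 8 * (fps_X ^ 3 * Q ^ 2)) ?N = 8 * fps_nth (Q ^ 2) (8 * n + 14)"
    by (simp add: numeral_fps_const fps_X_power_mult_nth add.commute)
  ultimately have "16 * int (sigma_div n1) - 16 * eta_coeff ?N = 16 * int (t_rep 1 1 3 12 n)"
    using t_rep_1_1_3_12[of n] by (simp add: Q_def)
  then show ?thesis by simp
qed

end
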